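(* Let $k$ be any field, $S=k[x,y,s,t]$, $F=xy(x-y)(sx-ty)=sx^3y-(t+s)x^2y^2+txy^3$, and $R=S/FS$. Let $\mathcal{S}$ be an infinite set of positive integers, and suppose that either $k$ has characteristic zero, or $k$ has prime characteristic $p$ and $\mathcal{S}$ contains infinitely many powers of $p$. Then the set $$\bigcup_{n\in\mathcal{S}}\operatorname{Ass}_R\left(\frac{R}{\langle x^n,y^n\rangle}\right)$$ is infinite.
   Context: $\langle x^n,y^n\rangle$ denotes the ideal of $R$ generated by the images of $x^n$ and $y^n$; $\operatorname{Ass}_R$ denotes the set of associated prime ideals of an $R$-module. *)

theory Defs
  imports "HOL-Algebra.Algebra" "HOL-Computational_Algebra.Primes"
begin

text \<open>The polynomial ring S = k[x,y,s,t] is built as the iterated univariate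
  polynomial ring ((k[x])[y])[s])[t].\<close>

definition P1 :: "('a, 'm) ring_scheme \<Rightarrow> _" where "P1 K = UP K"
definition P2 :: "('a, 'm) ring_scheme \<Rightarrow> _" where "P2 K = UP (P1 K)"
definition P3 :: "('a, 'm) ring_scheme \<Rightarrow> _" where "P3 K = UP (P2 K)"
definition Spoly :: "('a, 'm) ring_scheme \<Rightarrow> _" where "Spoly K = UP (P3 K)"

definition varx where
  "varx K = monom (Spoly K) (monom (P3 K) (monom (P2 K) (monom (P1 K) \<one>\<^bsub>K\<^esub> 1) 0) 0) 0"
definition vary where
  "vary K = monom (Spoly K) (monom (P3 K) (monom (P2 K) \<one>\<^bsub>P1 K\<^esub> 1) 0) 0"
definition vars where
  "vars K = monom (Spoly K) (monom (P3 K) \<one>\<^bsub>P2 K\<^esub> 1) 0"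
definition vart where
  "vart K = monom (Spoly K) \<one>\<^bsub>P3 K\<^esub> 1"

definition polyF where
  "polyF K = (let S = Spoly K; x = varx K; y = vary K; s = vars K; t = vart K in
     x \<otimes>\<^bsub>S\<^esub> y \<otimes>\<^bsub>S\<^esub> (x \<ominus>\<^bsub>S\<^esub> y) \<otimes>\<^bsub>S\<^esub> (s \<otimes>\<^bsub>S\<^esub> x \<ominus>\<^bsub>S\<^esub> t \<otimes>\<^bsub>S\<^esub> y))"

definition ringR where
  "ringR K = Spoly K Quot (PIdl\<^bsub>Spoly K\<^esub> (polyF K))"
definition xR where
  "xR K = (PIdl\<^bsub>Spoly K\<^esub> (polyF K)) +>\<^bsub>Spoly K\<^esub> (varx K)"
definition yR where
  "yR K = (PIdl\<^bsub>Spoly K\<^esub> (polyF K)) +>\<^bsub>Spoly K\<^esub> (vary K)"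

text \<open>Ass_R(R/J): prime ideals of R that are annihilators of elements a + J of R/J,
  i.e. of the form (J : a) = {r. r a \<in> J}.\<close>
definition ass_quot :: "('b, 'c) ring_scheme \<Rightarrow> 'b set \<Rightarrow> 'b set set" where
  "ass_quot R J = {P. primeideal P R \<and>
      (\<exists>a \<in> carrier R. P = {r \<in> carrier R. r \<otimes>\<^bsub>R\<^esub> a \<in> J})}"

end

theory Submission
  imports Defs
begin

text \<open>
  Put \<open>n = m + 2\<close>, \<open>N = m + 1\<close> and \<open>J = (x\<^sup>n, y\<^sup>n, F)\<close>. Modulo \<open>J\<close> the element
  \<open>e = s x\<^sup>2 y\<^sup>N\<close> is killed by \<open>x\<close>, by \<open>y\<close> and by \<open>G = (t\<^sup>N - s\<^sup>N) / (t - s)\<close>.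
  Let \<open>\<zeta> \<noteq> 1\<close> be an \<open>N\<close>-th root of unity in the algebraic closure \<open>L\<close> of \<open>K\<close>, let \<open>f\<close> be the
  homogenised minimal polynomial of \<open>\<zeta>\<close>, and write \<open>G = v f\<close>. Then the annihilator of \<open>v e\<close> modulo
  \<open>J\<close> is the kernel of \<open>\<phi> : S \<rightarrow> L[w]\<close>, \<open>x, y \<mapsto> 0\<close>, \<open>s \<mapsto> w\<close>, \<open>t \<mapsto> \<zeta> w\<close>. That the
  kernel \<open>(x, y, f)\<close> annihilates is clear. Conversely, restrict an identity
  \<open>g x\<^sup>2 y\<^sup>N = p x\<^sup>n + q y\<^sup>n + r F\<close> to the four lines \<open>y = 0\<close>, \<open>x = 0\<close>, \<open>x = y\<close>, \<open>x = \<zeta> y\<close> on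
  which \<open>F\<close> vanishes after applying \<open>\<phi>\<close> to \<open>s\<close> and \<open>t\<close>, and compare coefficients in degree
  \<open>n + 1\<close>: this gives \<open>(\<zeta>\<^sup>2 - \<zeta>) \<phi>(g) = 0\<close>. When \<open>N\<close> is invertible in \<open>K\<close>, \<open>\<zeta>\<close> is a simple root, so
  \<open>\<phi>(v) \<noteq> 0\<close>, and there are \<open>N\<close> roots of unity; as the kernel determines the order of \<open>\<zeta>\<close>,
  infinitely many primes arise.
\<close>

section \<open>Induction and substitution for iterated polynomial rings\<close>

lemma (in UP_cring) UP_induct [consumes 1, case_names const add var]:
  assumes p: "p \<in> carrier P"
    and const: "\<And>a. a \<in> carrier R \<Longrightarrow> Q (up_ring.monom P a 0)"
    and add: "\<And>p q. p \<in> carrier P \<Longrightarrow> q \<in> carrier P \<Longrightarrow> Q p \<Longrightarrow> Q q \<Longrightarrow> Q (p \<oplus>\<^bsub>P\<^esub> q)"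
    and var: "\<And>p. p \<in> carrier P \<Longrightarrow> Q p \<Longrightarrow> Q (up_ring.monom P \<one> 1 \<otimes>\<^bsub>P\<^esub> p)"
  shows "Q p"
proof -
  have mon: "Q (up_ring.monom P a n)" if a: "a \<in> carrier R" for a n
  proof (induction n)
    case 0
    then show ?case using const[OF a] .
  next
    case (Suc n)
    have "up_ring.monom P \<one> 1 \<otimes>\<^bsub>P\<^esub> up_ring.monom P a n = up_ring.monom P a (Suc n)"
      using monom_mult[of \<one> a 1 n] a by simp
    then show ?case using var[of "up_ring.monom P a n"] Suc a by simp
  qed
  have "Q (\<Oplus>\<^bsub>P\<^esub> i \<in> {..n}. up_ring.monom P (up_ring.coeff P p i) i)" for n
  proof (induction n)
    case 0
    then show ?case using mon[of "up_ring.coeff P p 0" 0] p by simp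
  next
    case (Suc n)
    then show ?case
      using add mon p by (simp add: Pi_def)
  qed
  then show ?thesis using up_repr[OF p] by metis
qed

lemma UP_hom_extends:
  assumes "cring R" "cring T" "\<psi> \<in> ring_hom R T" "\<xi> \<in> carrier T"
  shows "\<exists>h \<in> ring_hom (UP R) T.
    h (up_ring.monom (UP R) \<one>\<^bsub>R\<^esub> 1) = \<xi> \<and> (\<forall>a \<in> carrier R. h (up_ring.monom (UP R) a 0) = \<psi> a)"
proof -
  interpret R: cring R by fact
  interpret T: cring T by fact
  interpret UP_pre_univ_prop R T \<psi> "UP R"
    by (rule UP_pre_univ_propI) (use assms in auto)
  show ?thesis
    using eval_ring_hom[OF assms(4)] eval_monom1[OF assms(4)] eval_const[OF assms(4)] by blast
qed

definition const4 where
  "const4 K a = up_ring.monom (Spoly K) (up_ring.monom (P3 K) (up_ring.monom (P2 K) (up_ring.monom (P1 K) a 0) 0) 0) 0"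

context
  fixes K :: "('a, 'm) ring_scheme"
  assumes K: "cring K"
begin

interpretation K1: UP_cring K "P1 K"
  using K by (simp_all add: UP_cring_def P1_def)
interpretation K2: UP_cring "P1 K" "P2 K"
  using K1.UP_cring by (simp_all add: UP_cring_def P2_def)
interpretation K3: UP_cring "P2 K" "P3 K"
  using K2.UP_cring by (simp_all add: UP_cring_def P3_def)
interpretation K4: UP_cring "P3 K" "Spoly K"
  using K3.UP_cring by (simp_all add: UP_cring_def Spoly_def)

lemma cring_Spoly: "cring (Spoly K)"
  by (rule K4.UP_cring)

lemma const4_ring_hom: "const4 K \<in> ring_hom K (Spoly K)"
proof -
  have "const4 K = (\<lambda>a. up_ring.monom (Spoly K) a 0) \<circ> ((\<lambda>a. up_ring.monom (P3 K) a 0) \<circ>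
      ((\<lambda>a. up_ring.monom (P2 K) a 0) \<circ> (\<lambda>a. up_ring.monom (P1 K) a 0)))"
    by (auto simp: const4_def)
  then show ?thesis
    using K1.const_ring_hom K2.const_ring_hom K3.const_ring_hom K4.const_ring_hom
    by (auto intro!: ring_hom_trans)
qed

lemma Spoly_vars_closed:
  "varx K \<in> carrier (Spoly K)" "vary K \<in> carrier (Spoly K)"
  "vars K \<in> carrier (Spoly K)" "vart K \<in> carrier (Spoly K)"
  by (simp_all add: varx_def vary_def vars_def vart_def)

text \<open>The levels are climbed from the innermost ring outwards; at each level
  \<open>UP_induct\<close> leaves only constants, which the previous level settles, and
  multiplication by the new variable. Later arguments use this rule in place of the nested
  representation.\<close>

lemma Spoly_induct [consumes 1, case_names const add x y s t]:
  assumes p: "p \<in> carrier (Spoly K)"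
    and const: "\<And>a. a \<in> carrier K \<Longrightarrow> Q (const4 K a)"
    and add: "\<And>p q. p \<in> carrier (Spoly K) \<Longrightarrow> q \<in> carrier (Spoly K) \<Longrightarrow> Q p \<Longrightarrow> Q q \<Longrightarrow> Q (p \<oplus>\<^bsub>Spoly K\<^esub> q)"
    and x: "\<And>p. p \<in> carrier (Spoly K) \<Longrightarrow> Q p \<Longrightarrow> Q (varx K \<otimes>\<^bsub>Spoly K\<^esub> p)"
    and y: "\<And>p. p \<in> carrier (Spoly K) \<Longrightarrow> Q p \<Longrightarrow> Q (vary K \<otimes>\<^bsub>Spoly K\<^esub> p)"
    and s: "\<And>p. p \<in> carrier (Spoly K) \<Longrightarrow> Q p \<Longrightarrow> Q (vars K \<otimes>\<^bsub>Spoly K\<^esub> p)"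
    and t: "\<And>p. p \<in> carrier (Spoly K) \<Longrightarrow> Q p \<Longrightarrow> Q (vart K \<otimes>\<^bsub>Spoly K\<^esub> p)"
  shows "Q p"
proof -
  \<comment> \<open>Multiplicativity of the embeddings of constants, oriented to collapse a product
    of embedded elements into the embedding of a product formed at an inner level.\<close>
  note mm = K2.monom_mult[of _ _ 0 0, symmetric] K3.monom_mult[of _ _ 0 0, symmetric]
    K4.monom_mult[of _ _ 0 0, symmetric]
  have l1: "Q (up_ring.monom (Spoly K) (up_ring.monom (P3 K) (up_ring.monom (P2 K) a 0) 0) 0)"
    if "a \<in> carrier (P1 K)" for a
    using that
  proof (induction rule: K1.UP_induct)
    case (const a)
    then show ?case using assms(2) by (simp add: const4_def)
  next
    case (add p q)
    then show ?case using assms(3) by simp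
  next
    case (var p)
    then show ?case
      using x[of "up_ring.monom (Spoly K) (up_ring.monom (P3 K) (up_ring.monom (P2 K) p 0) 0) 0"]
      by (simp add: varx_def del: K2.monom_mult K3.monom_mult K4.monom_mult) (simp add: mm)
  qed
  have l2: "Q (up_ring.monom (Spoly K) (up_ring.monom (P3 K) a 0) 0)" if "a \<in> carrier (P2 K)" for a
    using that
  proof (induction rule: K2.UP_induct)
    case (const a)
    then show ?case using l1 by simp
  next
    case (add p q)
    then show ?case using assms(3) by simp
  next
    case (var p)
    then show ?case
      using y[of "up_ring.monom (Spoly K) (up_ring.monom (P3 K) p 0) 0"]
      by (simp add: vary_def del: K3.monom_mult K4.monom_mult) (simp add: mm)
  qed
  have l3: "Q (up_ring.monom (Spoly K) a 0)" if "a \<in> carrier (P3 K)" for a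
    using that
  proof (induction rule: K3.UP_induct)
    case (const a)
    then show ?case using l2 by simp
  next
    case (add p q)
    then show ?case using assms(3) by simp
  next
    case (var p)
    then show ?case
      using s[of "up_ring.monom (Spoly K) p 0"]
      by (simp add: vars_def del: K4.monom_mult) (simp add: mm)
  qed
  show ?thesis
    using p
  proof (induction rule: K4.UP_induct)
    case (const a)
    then show ?case using l3 by simp
  next
    case (add p q)
    then show ?case using assms(3) by simp
  next
    case (var p)
    then show ?case
      using t[of p] by (simp add: vart_def)
  qed
qed

text \<open>Four successive evaluations, each taking the previous one as its homomorphism on
  constants. All substitutions below come from this universal property.\<close>

lemma Spoly_hom_exists:
  assumes T: "cring T" and \<psi>: "\<psi> \<in> ring_hom K T"
    and "\<xi> \<in> carrier T" "\<eta> \<in> carrier T" "\<sigma> \<in> carrier T" "\<tau> \<in> carrier T"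
  shows "\<exists>h \<in> ring_hom (Spoly K) T. h (varx K) = \<xi> \<and> h (vary K) = \<eta> \<and> h (vars K) = \<sigma>
    \<and> h (vart K) = \<tau> \<and> (\<forall>a \<in> carrier K. h (const4 K a) = \<psi> a)"
proof -
  obtain h1 where h1: "h1 \<in> ring_hom (P1 K) T" "h1 (up_ring.monom (P1 K) \<one>\<^bsub>K\<^esub> 1) = \<xi>"
    "\<And>a. a \<in> carrier K \<Longrightarrow> h1 (up_ring.monom (P1 K) a 0) = \<psi> a"
    using UP_hom_extends[OF K T \<psi> assms(3)] unfolding P1_def by blast
  obtain h2 where h2: "h2 \<in> ring_hom (P2 K) T" "h2 (up_ring.monom (P2 K) \<one>\<^bsub>P1 K\<^esub> 1) = \<eta>"
    "\<And>a. a \<in> carrier (P1 K) \<Longrightarrow> h2 (up_ring.monom (P2 K) a 0) = h1 a"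
    using UP_hom_extends[OF K1.UP_cring T h1(1) assms(4)] unfolding P2_def by blast
  obtain h3 where h3: "h3 \<in> ring_hom (P3 K) T" "h3 (up_ring.monom (P3 K) \<one>\<^bsub>P2 K\<^esub> 1) = \<sigma>"
    "\<And>a. a \<in> carrier (P2 K) \<Longrightarrow> h3 (up_ring.monom (P3 K) a 0) = h2 a"
    using UP_hom_extends[OF K2.UP_cring T h2(1) assms(5)] unfolding P3_def by blast
  obtain h4 where h4: "h4 \<in> ring_hom (Spoly K) T" "h4 (up_ring.monom (Spoly K) \<one>\<^bsub>P3 K\<^esub> 1) = \<tau>"
    "\<And>a. a \<in> carrier (P3 K) \<Longrightarrow> h4 (up_ring.monom (Spoly K) a 0) = h3 a"
    using UP_hom_extends[OF K3.UP_cring T h3(1) assms(6)] unfolding Spoly_def by blast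
  show ?thesis
    by (intro bexI[OF _ h4(1)])
      (use h1 h2 h3 h4 in \<open>simp add: varx_def vary_def vars_def vart_def const4_def\<close>)
qed

end

section \<open>Relations modulo x^n, y^n and F\<close>

context cring
begin

text \<open>This is the sum of s^(j-1-i) t^i over i < j, that is (t^j - s^j) / (t - s). The
  recursion is the one met when telescoping in \<open>socle_relations\<close>.\<close>

fun geom :: "'a \<Rightarrow> 'a \<Rightarrow> nat \<Rightarrow> 'a" where
  "geom s t 0 = \<zero>"
| "geom s t (Suc j) = s \<otimes> geom s t j \<oplus> t [^] j"

lemma geom_closed [simp]:
  "s \<in> carrier R \<Longrightarrow> t \<in> carrier R \<Longrightarrow> geom s t j \<in> carrier R"
  by (induction j) auto

lemma geom_mult:
  assumes [simp]: "s \<in> carrier R" "t \<in> carrier R"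
  shows "(t \<ominus> s) \<otimes> geom s t j = t [^] j \<ominus> s [^] j"
proof (induction j)
  case 0
  show ?case by (simp add: minus_eq r_neg)
next
  case (Suc j)
  define g T U where "g = geom s t j" and "T = t [^] j" and "U = s [^] j"
  have [simp]: "g \<in> carrier R" "T \<in> carrier R" "U \<in> carrier R"
    by (simp_all add: g_def T_def U_def)
  have IH: "(t \<ominus> s) \<otimes> g = T \<ominus> U" using Suc by (simp add: g_def T_def U_def)
  have "(t \<ominus> s) \<otimes> (s \<otimes> g \<oplus> T) = s \<otimes> ((t \<ominus> s) \<otimes> g) \<oplus> (t \<ominus> s) \<otimes> T"
    using \<open>g \<in> carrier R\<close> \<open>T \<in> carrier R\<close> assms by algebra
  also have "\<dots> = T \<otimes> t \<ominus> U \<otimes> s"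
    unfolding IH using \<open>U \<in> carrier R\<close> \<open>T \<in> carrier R\<close> assms by algebra
  finally show ?case by (simp add: g_def T_def U_def)
qed

text \<open>Expanding F turns s x^3 y into a combination of x^2 y^2 and x y^3, and a further factor
  y^m kills both; this is the relation for x. The relation for \<open>geom\<close> comes from
  telescoping along the monomials of degree m + 3. Equations in a ring stand for congruences modulo
  J here; \<open>socle_relations_ideal\<close> translates back.\<close>

lemma socle_relations:
  assumes [simp]: "x \<in> carrier R" "y \<in> carrier R" "s \<in> carrier R" "t \<in> carrier R"
    and xn: "x [^] (m + 2) = \<zero>" and yn: "y [^] (m + 2) = \<zero>"
    and F: "x \<otimes> y \<otimes> (x \<ominus> y) \<otimes> (s \<otimes> x \<ominus> t \<otimes> y) = \<zero>"
  shows "x \<otimes> (s \<otimes> x [^] (2::nat) \<otimes> y [^] (m + 1)) = \<zero>"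
    and "y \<otimes> (s \<otimes> x [^] (2::nat) \<otimes> y [^] (m + 1)) = \<zero>"
    and "geom s t (m + 1) \<otimes> (x [^] (2::nat) \<otimes> y [^] (m + 1)) = \<zero>"
proof -
  note cl = assms(1-4)
  have sq: "x [^] (2::nat) = x \<otimes> x" by (simp add: numeral_2_eq_2)
  define Y where "Y = y [^] m"
  have Y [simp]: "Y \<in> carrier R" by (simp add: Y_def)
  have y1: "y [^] (m + 1) = Y \<otimes> y" by (simp add: Y_def)
  have yz: "Y \<otimes> y \<otimes> y = \<zero>" using yn by (simp add: Y_def)
  show "y \<otimes> (s \<otimes> x [^] (2::nat) \<otimes> y [^] (m + 1)) = \<zero>"
  proof -
    have "y \<otimes> (s \<otimes> x [^] (2::nat) \<otimes> y [^] (m + 1)) = s \<otimes> x \<otimes> x \<otimes> (Y \<otimes> y \<otimes> y)"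
      unfolding sq y1 using cl Y by algebra
    then show ?thesis by (simp add: yz)
  qed
  show "x \<otimes> (s \<otimes> x [^] (2::nat) \<otimes> y [^] (m + 1)) = \<zero>"
  proof -
    have "x \<otimes> (s \<otimes> x [^] (2::nat) \<otimes> y [^] (m + 1)) =
      Y \<otimes> (x \<otimes> y \<otimes> (x \<ominus> y) \<otimes> (s \<otimes> x \<ominus> t \<otimes> y))
      \<oplus> ((t \<oplus> s) \<otimes> x \<otimes> x \<ominus> t \<otimes> x \<otimes> y) \<otimes> (Y \<otimes> y \<otimes> y)"
      unfolding sq y1 using cl Y by algebra
    then show ?thesis by (simp add: yz F)
  qed
  \<comment> \<open>In contrast to the overview, this e lacks the factor s: the relation with
    \<open>geom\<close> already holds without it.\<close>
  define e where "e = x [^] (2::nat) \<otimes> y [^] (m + 1)"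
  have e [simp]: "e \<in> carrier R" by (simp add: e_def)
  \<comment> \<open>F = 0 says s (x^3 y - x^2 y^2) = t (x^2 y^2 - x y^3), so each difference of
    neighbouring monomials, times s, is t times the preceding difference. The start j = 0 is e,
    because y^(m+2) = 0. The second conjunct sums these differences.\<close>
  have key: "s [^] j \<otimes> (x [^] (j + 2) \<otimes> y [^] (k + 1) \<ominus> x [^] (j + 1) \<otimes> y [^] (k + 2)) = t [^] j \<otimes> e
      \<and> s [^] j \<otimes> (x [^] (j + 2) \<otimes> y [^] (k + 1)) = geom s t (Suc j) \<otimes> e"
    if "j + k = m" for j k
    using that
  proof (induction j arbitrary: k)
    case 0
    then show ?case using yn by (simp add: e_def numeral_2_eq_2 minus_eq)
  next
    case (Suc j)
    define V W A T g where "V = x [^] j" and "W = y [^] k" and "A = s [^] j" and "T = t [^] j"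
      and "g = geom s t (Suc j)"
    have cl': "V \<in> carrier R" "W \<in> carrier R" "A \<in> carrier R" "T \<in> carrier R" "g \<in> carrier R"
      by (auto simp: V_def W_def A_def T_def g_def)
    have IH: "A \<otimes> (V \<otimes> x \<otimes> x \<otimes> (W \<otimes> y \<otimes> y) \<ominus> V \<otimes> x \<otimes> (W \<otimes> y \<otimes> y \<otimes> y)) = T \<otimes> e"
      "A \<otimes> (V \<otimes> x \<otimes> x \<otimes> (W \<otimes> y \<otimes> y)) = g \<otimes> e"
      using Suc.IH[of "Suc k"] Suc.prems by (simp_all add: V_def W_def A_def T_def g_def)
    have 1: "A \<otimes> s \<otimes> (V \<otimes> x \<otimes> x \<otimes> x \<otimes> (W \<otimes> y) \<ominus> V \<otimes> x \<otimes> x \<otimes> (W \<otimes> y \<otimes> y))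
      = A \<otimes> V \<otimes> W \<otimes> (x \<otimes> y \<otimes> (x \<ominus> y) \<otimes> (s \<otimes> x \<ominus> t \<otimes> y))
        \<oplus> t \<otimes> (A \<otimes> (V \<otimes> x \<otimes> x \<otimes> (W \<otimes> y \<otimes> y) \<ominus> V \<otimes> x \<otimes> (W \<otimes> y \<otimes> y \<otimes> y)))"
      using cl cl' by algebra
    have 2: "A \<otimes> s \<otimes> (V \<otimes> x \<otimes> x \<otimes> x \<otimes> (W \<otimes> y) \<ominus> V \<otimes> x \<otimes> x \<otimes> (W \<otimes> y \<otimes> y)) = T \<otimes> t \<otimes> e"
      unfolding 1 F IH using cl cl' e by algebra
    have "A \<otimes> s \<otimes> (V \<otimes> x \<otimes> x \<otimes> x \<otimes> (W \<otimes> y))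
      = A \<otimes> s \<otimes> (V \<otimes> x \<otimes> x \<otimes> x \<otimes> (W \<otimes> y) \<ominus> V \<otimes> x \<otimes> x \<otimes> (W \<otimes> y \<otimes> y))
        \<oplus> s \<otimes> (A \<otimes> (V \<otimes> x \<otimes> x \<otimes> (W \<otimes> y \<otimes> y)))"
      using cl cl' by algebra
    also have "\<dots> = (s \<otimes> g \<oplus> T \<otimes> t) \<otimes> e"
      unfolding 2 IH using cl cl' e by algebra
    finally show ?case using 2
      by (simp add: V_def W_def A_def T_def g_def del: geom.simps) (simp)
  qed
  \<comment> \<open>At the far end j = m, k = 0 the monomial is x^(m+2) y, which vanishes.\<close>
  have "s [^] m \<otimes> (x [^] (m + 2) \<otimes> y [^] (0 + 1::nat)) = geom s t (Suc m) \<otimes> e"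
    by (rule key[of m 0, OF add_0_right, THEN conjunct2])
  then show "geom s t (m + 1) \<otimes> (x [^] (2::nat) \<otimes> y [^] (m + 1)) = \<zero>"
    unfolding xn e_def by (simp del: geom.simps)
qed

end

section \<open>Rings generated by x, y, s, t over K, and forms in s and t\<close>

text \<open>Only generation is recorded, as an induction rule. That the generators are free enters
  later, through the homomorphism \<phi> and the assumption \<open>hom_exists\<close>.\<close>

locale four_generated = cring S for S (structure) +
  fixes K :: "('k, 'm) ring_scheme" and c x y s t
  assumes field_K: "field K"
    and const_hom: "c \<in> ring_hom K S"
    and gens_closed [simp]: "x \<in> carrier S" "y \<in> carrier S" "s \<in> carrier S" "t \<in> carrier S"
    and gen_induct: "\<And>Q p. \<lbrakk>p \<in> carrier S;
      \<And>a. a \<in> carrier K \<Longrightarrow> Q (c a);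
      \<And>p q. \<lbrakk>p \<in> carrier S; q \<in> carrier S; Q p; Q q\<rbrakk> \<Longrightarrow> Q (p \<oplus> q);
      \<And>p. \<lbrakk>p \<in> carrier S; Q p\<rbrakk> \<Longrightarrow> Q (x \<otimes> p);
      \<And>p. \<lbrakk>p \<in> carrier S; Q p\<rbrakk> \<Longrightarrow> Q (y \<otimes> p);
      \<And>p. \<lbrakk>p \<in> carrier S; Q p\<rbrakk> \<Longrightarrow> Q (s \<otimes> p);
      \<And>p. \<lbrakk>p \<in> carrier S; Q p\<rbrakk> \<Longrightarrow> Q (t \<otimes> p)\<rbrakk> \<Longrightarrow> Q p"
begin

lemmas gen_induct' [consumes 1, case_names const add x y s t] = gen_induct

interpretation K: field K by (rule field_K)
interpretation c: ring_hom_cring K S c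
  by (rule ring_hom_cringI[OF K.is_cring is_cring const_hom])

lemma const_closed [simp]: "a \<in> carrier K \<Longrightarrow> c a \<in> carrier S"
  by (rule c.hom_closed)

text \<open>Binary forms of degree \<open>M\<close> in \<open>s, t\<close> whose degree in \<open>t\<close> is less than \<open>k\<close>;
  for \<open>k > M + 1\<close> the truncated subtraction makes this set meaningless.\<close>

primrec forms :: "nat \<Rightarrow> nat \<Rightarrow> 'a set" where
  "forms M 0 = {\<zero>}"
| "forms M (Suc k) = {u \<oplus> c a \<otimes> (s [^] (M - k) \<otimes> t [^] k) | u a. u \<in> forms M k \<and> a \<in> carrier K}"

lemma forms_closed: "u \<in> forms M k \<Longrightarrow> u \<in> carrier S"
  by (induction k arbitrary: u) auto

lemma forms_SucI:
  "u \<in> forms M k \<Longrightarrow> a \<in> carrier K \<Longrightarrow> v = u \<oplus> c a \<otimes> (s [^] (M - k) \<otimes> t [^] k) \<Longrightarrow> v \<in> forms M (Suc k)"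
  by auto

lemma forms_Suc_mono: "u \<in> forms M k \<Longrightarrow> u \<in> forms M (Suc k)"
  by (rule forms_SucI[of u _ _ "\<zero>\<^bsub>K\<^esub>"]) (auto dest: forms_closed)

lemma zero_in_forms: "\<zero> \<in> forms M k"
  by (induction k) (auto simp del: forms.simps(2) intro: forms_Suc_mono)

lemma forms_add: "u \<in> forms M k \<Longrightarrow> v \<in> forms M k \<Longrightarrow> u \<oplus> v \<in> forms M k"
proof (induction k arbitrary: u v)
  case (Suc k)
  then obtain u' a v' b where *: "u' \<in> forms M k" "v' \<in> forms M k" "a \<in> carrier K" "b \<in> carrier K"
    and u: "u = u' \<oplus> c a \<otimes> (s [^] (M - k) \<otimes> t [^] k)"
    and v: "v = v' \<oplus> c b \<otimes> (s [^] (M - k) \<otimes> t [^] k)" by auto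
  show ?case
  proof (rule forms_SucI)
    show "u' \<oplus> v' \<in> forms M k" using Suc.IH * by simp
    show "a \<oplus>\<^bsub>K\<^esub> b \<in> carrier K" using * by simp
    show "u \<oplus> v = u' \<oplus> v' \<oplus> c (a \<oplus>\<^bsub>K\<^esub> b) \<otimes> (s [^] (M - k) \<otimes> t [^] k)"
      using *(3,4) forms_closed[OF *(1)] forms_closed[OF *(2)]
      by (simp add: u v l_distr a_ac)
  qed
qed auto

lemma forms_scale: "u \<in> forms M k \<Longrightarrow> a \<in> carrier K \<Longrightarrow> c a \<otimes> u \<in> forms M k"
proof (induction k arbitrary: u)
  case (Suc k)
  then obtain u' b where *: "u' \<in> forms M k" "b \<in> carrier K"
    and u: "u = u' \<oplus> c b \<otimes> (s [^] (M - k) \<otimes> t [^] k)" by auto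
  show ?case
  proof (rule forms_SucI)
    show "c a \<otimes> u' \<in> forms M k" using Suc * by simp
    show "a \<otimes>\<^bsub>K\<^esub> b \<in> carrier K" using * Suc by simp
    show "c a \<otimes> u = c a \<otimes> u' \<oplus> c (a \<otimes>\<^bsub>K\<^esub> b) \<otimes> (s [^] (M - k) \<otimes> t [^] k)"
      using * Suc.prems forms_closed[OF *(1)] by (simp add: u r_distr m_assoc)
  qed
qed auto

lemma forms_neg:
  assumes "u \<in> forms M k" shows "\<ominus> u \<in> forms M k"
proof -
  have "c (\<ominus>\<^bsub>K\<^esub> \<one>\<^bsub>K\<^esub>) \<otimes> u \<in> forms M k" using assms by (intro forms_scale) auto
  then show ?thesis using forms_closed[OF assms] by (simp add: l_minus)
qed

text \<open>The bound on k keeps M - k a true subtraction for every monomial involved, so that its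
  exponent really grows by one. For t the two subtractions agree by themselves, and
  \<open>forms_mult_t\<close> has no such bound.\<close>

lemma forms_mult_s: "u \<in> forms M k \<Longrightarrow> k \<le> M + 1 \<Longrightarrow> s \<otimes> u \<in> forms (Suc M) k"
proof (induction k arbitrary: u)
  case (Suc k)
  then obtain u' b where *: "u' \<in> forms M k" "b \<in> carrier K"
    and u: "u = u' \<oplus> c b \<otimes> (s [^] (M - k) \<otimes> t [^] k)" by auto
  show ?case
  proof (rule forms_SucI)
    show "s \<otimes> u' \<in> forms (Suc M) k" using Suc * by simp
    show "s \<otimes> u = s \<otimes> u' \<oplus> c b \<otimes> (s [^] (Suc M - k) \<otimes> t [^] k)"
      using * Suc.prems forms_closed[OF *(1)] by (simp add: u r_distr m_ac Suc_diff_le)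
  qed fact
qed auto

lemma forms_mult_t: "u \<in> forms M k \<Longrightarrow> t \<otimes> u \<in> forms (Suc M) (Suc k)"
proof (induction k arbitrary: u)
  case 0
  then show ?case using zero_in_forms[of "Suc M" "Suc 0"] by simp
next
  case (Suc k)
  then obtain u' b where *: "u' \<in> forms M k" "b \<in> carrier K"
    and u: "u = u' \<oplus> c b \<otimes> (s [^] (M - k) \<otimes> t [^] k)" by auto
  show ?case
  proof (rule forms_SucI)
    show "t \<otimes> u' \<in> forms (Suc M) (Suc k)" using Suc.IH * by simp
    show "t \<otimes> u = t \<otimes> u' \<oplus> c b \<otimes> (s [^] (Suc M - Suc k) \<otimes> t [^] Suc k)"
      using * forms_closed[OF *(1)] by (simp add: u r_distr m_ac)
  qed fact
qed

lemma forms_mult_monomial: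
  assumes "u \<in> forms M k" "k \<le> M + 1"
  shows "s [^] i \<otimes> t [^] j \<otimes> u \<in> forms (M + i + j) (k + j)"
proof -
  have u: "u \<in> carrier S" using forms_closed assms by blast
  have 1: "t [^] j \<otimes> u \<in> forms (M + j) (k + j)" for j
  proof (induction j)
    case (Suc j)
    then show ?case using forms_mult_t[OF Suc] u by (simp add: m_ac del: forms.simps(2))
  qed (use assms u in simp)
  have "s [^] i \<otimes> (t [^] j \<otimes> u) \<in> forms (M + j + i) (k + j)"
  proof (induction i)
    case (Suc i)
    then show ?case using forms_mult_s[OF Suc] u assms by (simp add: m_ac)
  qed (use 1 u in simp)
  then show ?thesis using u by (simp add: m_assoc add.commute add.left_commute)
qed

text \<open>A t-degree of at most M in total degree M + i leaves s-exponent at least i in each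
  monomial. This trades a form of low t-degree for one of smaller total degree, to which minimality
  of d applies in \<open>min_form_dvd_form\<close>.\<close>

lemma forms_s_factor:
  "u \<in> forms (M + i) k \<Longrightarrow> k \<le> M + 1 \<Longrightarrow> \<exists>v \<in> forms M k. u = s [^] i \<otimes> v"
proof (induction k arbitrary: u)
  case (Suc k)
  then obtain u' b where *: "u' \<in> forms (M + i) k" "b \<in> carrier K"
    and u: "u = u' \<oplus> c b \<otimes> (s [^] (M + i - k) \<otimes> t [^] k)" by auto
  then obtain v where v: "v \<in> forms M k" "u' = s [^] i \<otimes> v" using Suc by fastforce
  have e: "s [^] (M + i - k) = s [^] i \<otimes> s [^] (M - k)"
    using Suc.prems by (simp add: nat_pow_mult add.commute)
  show ?case
  proof (rule bexI)
    show "v \<oplus> c b \<otimes> (s [^] (M - k) \<otimes> t [^] k) \<in> forms M (Suc k)" using v * by auto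
    show "u = s [^] i \<otimes> (v \<oplus> c b \<otimes> (s [^] (M - k) \<otimes> t [^] k))"
      unfolding u v e using * forms_closed[OF v(1)] by (simp add: r_distr m_ac)
  qed
qed auto

definition xy_ideal where
  "xy_ideal = {x \<otimes> p \<oplus> y \<otimes> q | p q. p \<in> carrier S \<and> q \<in> carrier S}"

lemma xy_ideal_closed: "u \<in> xy_ideal \<Longrightarrow> u \<in> carrier S"
  by (auto simp: xy_ideal_def)

lemma xy_idealI: "p \<in> carrier S \<Longrightarrow> q \<in> carrier S \<Longrightarrow> u = x \<otimes> p \<oplus> y \<otimes> q \<Longrightarrow> u \<in> xy_ideal"
  by (auto simp: xy_ideal_def)

lemma xy_ideal_add: "u \<in> xy_ideal \<Longrightarrow> v \<in> xy_ideal \<Longrightarrow> u \<oplus> v \<in> xy_ideal"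
proof -
  assume "u \<in> xy_ideal" "v \<in> xy_ideal"
  then obtain p q p' q' where *: "p \<in> carrier S" "q \<in> carrier S" "p' \<in> carrier S" "q' \<in> carrier S"
    and "u = x \<otimes> p \<oplus> y \<otimes> q" "v = x \<otimes> p' \<oplus> y \<otimes> q'" by (auto simp: xy_ideal_def)
  then show "u \<oplus> v \<in> xy_ideal"
    by (intro xy_idealI[of "p \<oplus> p'" "q \<oplus> q'"]) (use * in \<open>simp_all add: r_distr a_ac\<close>)
qed

lemma xy_ideal_mult: "u \<in> xy_ideal \<Longrightarrow> r \<in> carrier S \<Longrightarrow> r \<otimes> u \<in> xy_ideal"
proof -
  assume r: "r \<in> carrier S" and "u \<in> xy_ideal"
  then obtain p q where *: "p \<in> carrier S" "q \<in> carrier S"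
    and "u = x \<otimes> p \<oplus> y \<otimes> q" by (auto simp: xy_ideal_def)
  then show "r \<otimes> u \<in> xy_ideal"
    by (intro xy_idealI[of "r \<otimes> p" "r \<otimes> q"]) (use * r in \<open>simp_all add: r_distr m_ac\<close>)
qed

text \<open>Despite the name this is an ascending filtration: modulo (x, y), its elements are sums
  of forms in s, t of degrees below D. \<open>forms D (Suc D)\<close> contains all forms of degree
  D.\<close>

primrec graded :: "nat \<Rightarrow> 'a set" where
  "graded 0 = xy_ideal"
| "graded (Suc D) = {v \<oplus> u | v u. v \<in> graded D \<and> u \<in> forms D (Suc D)}"

lemma graded_closed: "u \<in> graded D \<Longrightarrow> u \<in> carrier S"
  by (induction D arbitrary: u) (auto simp del: forms.simps(2) dest: xy_ideal_closed forms_closed)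

lemma graded_SucI: "v \<in> graded D \<Longrightarrow> u \<in> forms D (Suc D) \<Longrightarrow> w = v \<oplus> u \<Longrightarrow> w \<in> graded (Suc D)"
  by (auto simp del: forms.simps(2))

lemma graded_mono: "u \<in> graded D \<Longrightarrow> D \<le> E \<Longrightarrow> u \<in> graded E"
proof (induction E)
  case (Suc E)
  show ?case
  proof (cases "D = Suc E")
    case False
    then show ?thesis
      using Suc by (intro graded_SucI[of u _ \<zero>] zero_in_forms) (auto dest: graded_closed)
  qed (use Suc in simp)
qed simp

lemma graded_add: "u \<in> graded D \<Longrightarrow> v \<in> graded D \<Longrightarrow> u \<oplus> v \<in> graded D"
proof (induction D arbitrary: u v)
  case (Suc D)
  then obtain u1 u2 v1 v2 where *: "u1 \<in> graded D" "v1 \<in> graded D"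
    "u2 \<in> forms D (Suc D)" "v2 \<in> forms D (Suc D)" and "u = u1 \<oplus> u2" "v = v1 \<oplus> v2"
    by (auto simp del: forms.simps(2))
  then show ?case
    using graded_closed[OF *(1)] graded_closed[OF *(2)] forms_closed[OF *(3)] forms_closed[OF *(4)]
    by (intro graded_SucI[of "u1 \<oplus> v1" _ "u2 \<oplus> v2"] Suc.IH forms_add) (simp_all add: a_ac del: forms.simps(2))
qed (simp add: xy_ideal_add)

lemma graded_mult_s: "u \<in> graded D \<Longrightarrow> s \<otimes> u \<in> graded (Suc D)"
proof (induction D arbitrary: u)
  case 0
  show ?case by (rule graded_mono[of _ 0]) (use 0 in \<open>simp_all add: xy_ideal_mult\<close>)
next
  case (Suc D)
  then obtain u1 u2 where *: "u1 \<in> graded D" "u2 \<in> forms D (Suc D)" and u: "u = u1 \<oplus> u2"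
    by (auto simp del: forms.simps(2))
  have u2: "s \<otimes> u2 \<in> forms (Suc D) (Suc (Suc D))"
    by (rule forms_Suc_mono, rule forms_mult_s[OF *(2)]) simp
  show ?case
    by (rule graded_SucI[OF Suc.IH[OF *(1)] u2])
      (use u graded_closed[OF *(1)] forms_closed[OF *(2)] in \<open>simp add: r_distr\<close>)
qed

lemma graded_mult_t: "u \<in> graded D \<Longrightarrow> t \<otimes> u \<in> graded (Suc D)"
proof (induction D arbitrary: u)
  case 0
  show ?case by (rule graded_mono[of _ 0]) (use 0 in \<open>simp_all add: xy_ideal_mult\<close>)
next
  case (Suc D)
  then obtain u1 u2 where *: "u1 \<in> graded D" "u2 \<in> forms D (Suc D)" and u: "u = u1 \<oplus> u2"
    by (auto simp del: forms.simps(2))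
  have u2: "t \<otimes> u2 \<in> forms (Suc D) (Suc (Suc D))"
    by (rule forms_mult_t[OF *(2)])
  show ?case
    by (rule graded_SucI[OF Suc.IH[OF *(1)] u2])
      (use u graded_closed[OF *(1)] forms_closed[OF *(2)] in \<open>simp add: r_distr\<close>)
qed

text \<open>Multiples of x and y lie in the bottom layer and multiplication by s or t climbs one
  layer. Properties of S can thus be proved by induction on the layer.\<close>

lemma graded_exhaust: "p \<in> carrier S \<Longrightarrow> \<exists>D. p \<in> graded D"
proof (induction p rule: gen_induct')
  case (const a)
  have "c a \<in> graded (Suc 0)"
  proof (rule graded_SucI)
    show "\<zero> \<in> graded 0" by (auto intro!: xy_idealI[of \<zero> \<zero>])
    show "c a \<in> forms 0 (Suc 0)" using const by (auto intro!: exI[of _ a])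
  qed (use const in simp)
  then show ?case ..
next
  case (add p q)
  then obtain D E where "p \<in> graded D" "q \<in> graded E" by blast
  then have "p \<in> graded (max D E)" "q \<in> graded (max D E)" by (auto intro: graded_mono)
  then show ?case using graded_add by blast
next
  case (x p)
  then have "x \<otimes> p \<in> graded 0" by (auto intro!: xy_idealI[of p \<zero>])
  then show ?case ..
next
  case (y p)
  then have "y \<otimes> p \<in> graded 0" by (auto intro!: xy_idealI[of \<zero> p])
  then show ?case ..
qed (use graded_mult_s graded_mult_t in blast)+

text \<open>Being monic in t of degree j makes the geometric sum a candidate in the search for a
  \<open>min_form\<close>.\<close>

lemma geom_forms: "\<exists>u \<in> forms j j. geom s t (Suc j) = t [^] j \<oplus> u"
proof (induction j)
  case (Suc j)
  then obtain u where u: "u \<in> forms j j" "geom s t (Suc j) = t [^] j \<oplus> u" by blast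
  have "s \<otimes> u \<oplus> c \<one>\<^bsub>K\<^esub> \<otimes> (s [^] (Suc j - j) \<otimes> t [^] j) \<in> forms (Suc j) (Suc j)"
    by (rule forms_SucI[OF forms_mult_s[OF u(1)]]) auto
  moreover have "geom s t (Suc (Suc j)) = t [^] Suc j \<oplus> (s \<otimes> u \<oplus> c \<one>\<^bsub>K\<^esub> \<otimes> (s [^] (Suc j - j) \<otimes> t [^] j))"
    unfolding geom.simps(2)[of _ _ "Suc j"] u(2) using forms_closed[OF u(1)]
    by (simp add: r_distr a_ac)
  ultimately show ?case by blast
qed simp

end

section \<open>The kernel of \<phi>\<close>

locale four_generated_root = four_generated S K c x y s t + L: field L
  for S (structure) and K :: "('k, 'm) ring_scheme" and c x y s t
    and L :: "('l, 'n) ring_scheme" +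
  fixes \<iota> \<zeta> \<phi>
  assumes \<iota>_hom: "\<iota> \<in> ring_hom K L"
    and \<zeta>_closed [simp]: "\<zeta> \<in> carrier L"
    and \<phi>_hom: "\<phi> \<in> ring_hom S (UP L)"
    and \<phi>_x: "\<phi> x = \<zero>\<^bsub>UP L\<^esub>" and \<phi>_y: "\<phi> y = \<zero>\<^bsub>UP L\<^esub>"
    and \<phi>_s: "\<phi> s = up_ring.monom (UP L) \<one>\<^bsub>L\<^esub> 1" and \<phi>_t: "\<phi> t = up_ring.monom (UP L) \<zeta> 1"
    and \<phi>_const: "\<And>a. a \<in> carrier K \<Longrightarrow> \<phi> (c a) = up_ring.monom (UP L) (\<iota> a) 0"
begin

interpretation K: field K by (rule field_K)
interpretation c: ring_hom_cring K S c
  by (rule ring_hom_cringI[OF K.is_cring is_cring const_hom])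
interpretation i: ring_hom_cring K L \<iota>
  by (rule ring_hom_cringI[OF K.is_cring L.is_cring \<iota>_hom])
interpretation B: UP_domain L "UP L"
  by unfold_locales simp
interpretation \<phi>: ring_hom_cring S "UP L" \<phi>
  by (rule ring_hom_cringI[OF is_cring B.UP_cring \<phi>_hom])

lemma \<phi>_monomial:
  assumes "k \<le> M" "a \<in> carrier K"
  shows "\<phi> (c a \<otimes> (s [^] (M - k) \<otimes> t [^] k)) = up_ring.monom (UP L) (\<iota> a \<otimes>\<^bsub>L\<^esub> \<zeta> [^]\<^bsub>L\<^esub> k) M"
proof -
  have "\<phi> (s [^] (M - k)) = up_ring.monom (UP L) \<one>\<^bsub>L\<^esub> (M - k)"
    and "\<phi> (t [^] k) = up_ring.monom (UP L) (\<zeta> [^]\<^bsub>L\<^esub> k) k"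
    by (simp_all add: \<phi>_s \<phi>_t B.monom_pow)
  then have "\<phi> (c a \<otimes> (s [^] (M - k) \<otimes> t [^] k)) = up_ring.monom (UP L) (\<iota> a) 0
      \<otimes>\<^bsub>UP L\<^esub> (up_ring.monom (UP L) \<one>\<^bsub>L\<^esub> (M - k) \<otimes>\<^bsub>UP L\<^esub> up_ring.monom (UP L) (\<zeta> [^]\<^bsub>L\<^esub> k) k)"
    using assms by (simp add: \<phi>_const del: \<phi>.hom_pow)
  also have "\<dots> = up_ring.monom (UP L) (\<iota> a \<otimes>\<^bsub>L\<^esub> (\<one>\<^bsub>L\<^esub> \<otimes>\<^bsub>L\<^esub> \<zeta> [^]\<^bsub>L\<^esub> k)) (0 + (M - k + k))"
    using assms by (simp only: B.monom_mult i.hom_closed L.one_closed L.m_closed L.nat_pow_closed \<zeta>_closed)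
  finally show ?thesis using assms by simp
qed

lemma \<phi>_forms:
  "u \<in> forms M k \<Longrightarrow> k \<le> M + 1 \<Longrightarrow> \<exists>l \<in> carrier L. \<phi> u = up_ring.monom (UP L) l M"
proof (induction k arbitrary: u)
  case 0
  then show ?case by (auto intro!: bexI[of _ "\<zero>\<^bsub>L\<^esub>"])
next
  case (Suc k)
  then obtain u' b where *: "u' \<in> forms M k" "b \<in> carrier K"
    and u: "u = u' \<oplus> c b \<otimes> (s [^] (M - k) \<otimes> t [^] k)" by auto
  obtain l where l: "l \<in> carrier L" "\<phi> u' = up_ring.monom (UP L) l M"
    using Suc.IH[OF *(1)] Suc.prems(2) by auto
  have "\<phi> u = up_ring.monom (UP L) (l \<oplus>\<^bsub>L\<^esub> \<iota> b \<otimes>\<^bsub>L\<^esub> \<zeta> [^]\<^bsub>L\<^esub> k) M"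
    using \<phi>_monomial[of k M b] Suc.prems * l forms_closed[OF *(1)]
    by (simp add: u del: \<phi>.hom_mult)
  moreover have "l \<oplus>\<^bsub>L\<^esub> \<iota> b \<otimes>\<^bsub>L\<^esub> \<zeta> [^]\<^bsub>L\<^esub> k \<in> carrier L" using l * by simp
  ultimately show ?case by blast
qed

lemma \<phi>_xy_ideal: "u \<in> xy_ideal \<Longrightarrow> \<phi> u = \<zero>\<^bsub>UP L\<^esub>"
  by (auto simp: xy_ideal_def \<phi>_x \<phi>_y)

text \<open>A form of degree i goes to a multiple of w^i, with w the variable of
  \<open>UP L\<close>, so layer D reaches only powers below w^D. Hence the coefficient at w^D of an
  element of layer D + 1 comes from its top form alone.\<close>

lemma \<phi>_graded: "u \<in> graded D \<Longrightarrow> D \<le> j \<Longrightarrow> up_ring.coeff (UP L) (\<phi> u) j = \<zero>\<^bsub>L\<^esub>"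
proof (induction D arbitrary: u)
  case 0
  then show ?case by (simp add: \<phi>_xy_ideal)
next
  case (Suc D)
  then obtain u1 u2 where *: "u1 \<in> graded D" "u2 \<in> forms D (Suc D)" and u: "u = u1 \<oplus> u2"
    by (auto simp del: forms.simps(2))
  obtain l where "l \<in> carrier L" "\<phi> u2 = up_ring.monom (UP L) l D" using \<phi>_forms[OF *(2)] by auto
  then show ?case using Suc.IH[OF *(1)] Suc.prems graded_closed[OF *(1)] forms_closed[OF *(2)]
    by (simp add: u)
qed

text \<open>The role of the homogenised minimal polynomial of \<open>\<zeta>\<close> over \<open>K\<close> is played by a form of minimal
  degree, monic in \<open>t\<close>, that vanishes at \<open>(1, \<zeta>)\<close>.\<close>

definition min_form :: "nat \<Rightarrow> 'a \<Rightarrow> bool" where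
  "min_form d f \<longleftrightarrow> (\<exists>u \<in> forms d d. f = t [^] d \<oplus> u) \<and> \<phi> f = \<zero>\<^bsub>UP L\<^esub>
    \<and> (\<forall>k < d. \<forall>u \<in> forms k k. \<phi> (t [^] k \<oplus> u) \<noteq> \<zero>\<^bsub>UP L\<^esub>)"

text \<open>The geometric sum attains degree j, so a least degree exists.\<close>

lemma min_form_exists:
  assumes "\<phi> (geom s t (Suc j)) = \<zero>\<^bsub>UP L\<^esub>"
  shows "\<exists>d f. min_form d f"
proof -
  define Q where "Q = (\<lambda>d. \<exists>u \<in> forms d d. \<phi> (t [^] d \<oplus> u) = \<zero>\<^bsub>UP L\<^esub>)"
  have "Q j" using geom_forms[of j] assms unfolding Q_def by metis
  then have "Q (LEAST d. Q d)" by (rule LeastI)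
  moreover have "\<not> Q k" if "k < (LEAST d. Q d)" for k using not_less_Least[OF that] .
  ultimately show ?thesis unfolding min_form_def Q_def by blast
qed

lemma min_form_closed: "min_form d f \<Longrightarrow> f \<in> carrier S"
  by (auto simp: min_form_def dest: forms_closed)

lemma \<phi>_s_pow_nonzero: "\<phi> (s [^] (i::nat)) \<noteq> \<zero>\<^bsub>UP L\<^esub>"
proof -
  have "\<phi> (s [^] i) = up_ring.monom (UP L) \<one>\<^bsub>L\<^esub> i" by (simp add: \<phi>_s B.monom_pow)
  then have "up_ring.coeff (UP L) (\<phi> (s [^] i)) i = \<one>\<^bsub>L\<^esub>" by simp
  then show ?thesis by auto
qed

text \<open>Division with remainder by f, which is monic in t. A leading term of t-degree at least d
  is removed by a multiple of f; one of t-degree below d must have coefficient zero by minimality of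
  d.\<close>

lemma min_form_dvd_form:
  assumes f: "min_form d f"
  shows "u \<in> forms M k \<Longrightarrow> k \<le> M + 1 \<Longrightarrow> \<phi> u = \<zero>\<^bsub>UP L\<^esub> \<Longrightarrow> \<exists>v \<in> carrier S. u = v \<otimes> f"
proof (induction k arbitrary: u)
  case 0
  then show ?case using min_form_closed[OF f] by (auto intro!: bexI[of _ \<zero>])
next
  case (Suc k)
  have fc [simp]: "f \<in> carrier S" using min_form_closed[OF f] .
  from Suc obtain u' a where *: "u' \<in> forms M k" and a [simp]: "a \<in> carrier K"
    and u: "u = u' \<oplus> c a \<otimes> (s [^] (M - k) \<otimes> t [^] k)" by auto
  have u'c [simp]: "u' \<in> carrier S" using forms_closed[OF *] .
  have k: "k \<le> M" using Suc by simp
  show ?case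
  proof (cases "k < d")
    case True
    \<comment> \<open>Otherwise, after scaling by 1/a and cancelling s^(M-k), a monic form of degree
      k < d would be killed by \<phi>. Cancelling is possible since \<phi> sends s^(M-k) to a
      nonzero element of a domain.\<close>
    have "a = \<zero>\<^bsub>K\<^esub>"
    proof (rule ccontr)
      assume "a \<noteq> \<zero>\<^bsub>K\<^esub>"
      define b where "b = inv\<^bsub>K\<^esub> a"
      have b [simp]: "b \<in> carrier K" and ba: "b \<otimes>\<^bsub>K\<^esub> a = \<one>\<^bsub>K\<^esub>"
        using \<open>a \<noteq> \<zero>\<^bsub>K\<^esub>\<close> K.field_Units by (auto simp: b_def)
      have cba: "c b \<otimes> c a = \<one>" using c.hom_mult[OF b a] ba by simp
      have "c b \<otimes> u' \<in> forms (k + (M - k)) k" using forms_scale[OF *] k by simp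
      from forms_s_factor[OF this] obtain v where v: "v \<in> forms k k" "c b \<otimes> u' = s [^] (M - k) \<otimes> v"
        by auto
      have vc [simp]: "v \<in> carrier S" using forms_closed v by blast
      have "c b \<otimes> u = c b \<otimes> u' \<oplus> (c b \<otimes> c a) \<otimes> (s [^] (M - k) \<otimes> t [^] k)"
        by (simp add: u r_distr m_assoc)
      also have "\<dots> = s [^] (M - k) \<otimes> (t [^] k \<oplus> v)"
        by (simp add: v cba r_distr a_comm)
      finally have cu: "c b \<otimes> u = s [^] (M - k) \<otimes> (t [^] k \<oplus> v)" .
      have "\<phi> (s [^] (M - k)) \<otimes>\<^bsub>UP L\<^esub> \<phi> (t [^] k \<oplus> v) = \<phi> (c b \<otimes> u)"
        unfolding cu by (rule \<phi>.hom_mult[symmetric]) auto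
      also have "\<dots> = \<zero>\<^bsub>UP L\<^esub>"
        using Suc.prems forms_closed[OF Suc.prems(1)] by simp
      finally have "\<phi> (t [^] k \<oplus> v) = \<zero>\<^bsub>UP L\<^esub>"
        using \<phi>_s_pow_nonzero[of "M - k"] B.integral[of "\<phi> (s [^] (M - k))"] by (metis \<phi>.hom_closed a_closed gens_closed(3,4) nat_pow_closed vc)
      then show False using f True v(1) unfolding min_form_def by blast
    qed
    then have "u = u'" by (simp add: u)
    then show ?thesis using Suc * by simp
  next
    case False
    obtain u0 where u0: "u0 \<in> forms d d" and f0: "f = t [^] d \<oplus> u0" using f by (auto simp: min_form_def)
    have u0c [simp]: "u0 \<in> carrier S" using forms_closed u0 by blast
    \<comment> \<open>A monomial, not the number m of n = m + 2. Subtracting c(a) m f cancels the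
      leading term of u and leaves t-degree below k.\<close>
    define m where "m = s [^] (M - k) \<otimes> t [^] (k - d)"
    have mc [simp]: "m \<in> carrier S" by (simp add: m_def)
    have "m \<otimes> u0 \<in> forms M k"
      using forms_mult_monomial[OF u0, of "M - k" "k - d"] False k by (simp add: m_def)
    then have w: "u' \<oplus> \<ominus> (c a \<otimes> (m \<otimes> u0)) \<in> forms M k"
      by (intro forms_add forms_neg forms_scale *) auto
    have e: "s [^] (M - k) \<otimes> t [^] k = m \<otimes> t [^] d"
      using False by (simp add: m_def m_assoc nat_pow_mult)
    have uu: "u = (u' \<oplus> \<ominus> (c a \<otimes> (m \<otimes> u0))) \<oplus> (c a \<otimes> m) \<otimes> f"
    proof -
      define A T where "A = c a" and "T = t [^] d"
      have "A \<in> carrier S" "T \<in> carrier S" by (auto simp: A_def T_def)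
      then show ?thesis unfolding u e f0 A_def[symmetric] T_def[symmetric]
        using mc u0c u'c by algebra
    qed
    have "\<phi> u = \<phi> (u' \<oplus> \<ominus> (c a \<otimes> (m \<otimes> u0)))"
      using f by (simp add: uu min_form_def)
    then obtain v where "v \<in> carrier S" "u' \<oplus> \<ominus> (c a \<otimes> (m \<otimes> u0)) = v \<otimes> f"
      using Suc.IH[OF w] Suc.prems by auto
    then have "u = (v \<oplus> c a \<otimes> m) \<otimes> f" "v \<oplus> c a \<otimes> m \<in> carrier S"
      unfolding uu by (simp_all add: l_distr)
    then show ?thesis by blast
  qed
qed

text \<open>The kernel is (x, y, f), by peeling off top forms: by \<open>\<phi>_graded\<close> the
  image of the top form cannot be cancelled by lower ones, so it vanishes separately and f divides
  that form.\<close>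

lemma kernel_decomposition:
  assumes f: "min_form d f" and p: "p \<in> carrier S" and zero: "\<phi> p = \<zero>\<^bsub>UP L\<^esub>"
  shows "\<exists>v \<in> carrier S. \<exists>w \<in> xy_ideal. p = v \<otimes> f \<oplus> w"
proof -
  have fc [simp]: "f \<in> carrier S" using min_form_closed[OF f] .
  have "\<exists>v \<in> carrier S. \<exists>w \<in> xy_ideal. p = v \<otimes> f \<oplus> w"
    if "p \<in> graded D" "\<phi> p = \<zero>\<^bsub>UP L\<^esub>" for p D
    using that
  proof (induction D arbitrary: p)
    case 0
    then show ?case by (intro bexI[of _ \<zero>] bexI[of _ p]) (auto dest: xy_ideal_closed)
  next
    case (Suc D)
    then obtain v u where *: "v \<in> graded D" "u \<in> forms D (Suc D)" and p: "p = v \<oplus> u"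
      by (auto simp del: forms.simps(2))
    have [simp]: "v \<in> carrier S" "u \<in> carrier S" using graded_closed[OF *(1)] forms_closed[OF *(2)] by auto
    obtain l where l: "l \<in> carrier L" "\<phi> u = up_ring.monom (UP L) l D" using \<phi>_forms[OF *(2)] by auto
    have "up_ring.coeff (UP L) (\<phi> p) D = l" using \<phi>_graded[OF *(1), of D] l by (simp add: p)
    then have "l = \<zero>\<^bsub>L\<^esub>" using Suc.prems by simp
    then have u0: "\<phi> u = \<zero>\<^bsub>UP L\<^esub>" using l by simp
    then have "\<phi> v = \<zero>\<^bsub>UP L\<^esub>" using Suc.prems by (simp add: p)
    then obtain v1 w where 1: "v1 \<in> carrier S" "w \<in> xy_ideal" "v = v1 \<otimes> f \<oplus> w" using Suc.IH[OF *(1)] by blast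
    obtain v2 where 2: "v2 \<in> carrier S" "u = v2 \<otimes> f" using min_form_dvd_form[OF f *(2)] u0 by auto
    show ?case
      by (intro bexI[of _ "v1 \<oplus> v2"] bexI[of _ w])
        (use 1 2 xy_ideal_closed[OF 1(2)] in \<open>simp_all add: p l_distr a_ac\<close>)
  qed
  then show ?thesis using graded_exhaust[OF p] zero by blast
qed

end

section \<open>Constant and linear coefficients\<close>

context UP_cring
begin

lemma coeff_mult_0:
  "p \<in> carrier P \<Longrightarrow> q \<in> carrier P \<Longrightarrow>
    up_ring.coeff P (p \<otimes>\<^bsub>P\<^esub> q) 0 = up_ring.coeff P p 0 \<otimes> up_ring.coeff P q 0"
  by simp

lemma coeff_mult_1:
  "p \<in> carrier P \<Longrightarrow> q \<in> carrier P \<Longrightarrow>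
    up_ring.coeff P (p \<otimes>\<^bsub>P\<^esub> q) (Suc 0) = up_ring.coeff P p 0 \<otimes> up_ring.coeff P q (Suc 0)
      \<oplus> up_ring.coeff P p (Suc 0) \<otimes> up_ring.coeff P q 0"
  by (simp add: Pi_def R.a_comm)

lemma coeff_pow_0:
  "p \<in> carrier P \<Longrightarrow> up_ring.coeff P (p [^]\<^bsub>P\<^esub> (k::nat)) 0 = up_ring.coeff P p 0 [^] k"
  by (induction k) (simp_all add: coeff_mult_0 del: coeff_mult)

text \<open>The power rule for derivatives, read modulo the square of the variable. It detects that
  \<zeta> is a simple root in \<open>cofactor_nonzero\<close>.\<close>

lemma coeff_pow_1:
  assumes p: "p \<in> carrier P" and 1: "up_ring.coeff P p (Suc 0) = \<one>"
  shows "up_ring.coeff P (p [^]\<^bsub>P\<^esub> Suc k) (Suc 0) = [Suc k] \<cdot> (up_ring.coeff P p 0 [^] k)"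
proof (induction k)
  case 0
  then show ?case using assms by simp
next
  case (Suc k)
  define q where "q = p [^]\<^bsub>P\<^esub> Suc k"
  have q: "q \<in> carrier P" using p by (simp add: q_def)
  have q0: "up_ring.coeff P q 0 = up_ring.coeff P p 0 [^] Suc k"
    unfolding q_def by (rule coeff_pow_0[OF p])
  have "up_ring.coeff P (p [^]\<^bsub>P\<^esub> Suc (Suc k)) (Suc 0) = up_ring.coeff P (q \<otimes>\<^bsub>P\<^esub> p) (Suc 0)"
    by (simp add: q_def)
  also have "\<dots> = up_ring.coeff P p 0 [^] Suc k
      \<oplus> [Suc k] \<cdot> (up_ring.coeff P p 0 [^] k) \<otimes> up_ring.coeff P p 0"
    unfolding coeff_mult_1[OF q p] 1 q0 using Suc p by (simp add: q_def)
  also have "\<dots> = up_ring.coeff P p 0 [^] Suc k \<oplus> [Suc k] \<cdot> (up_ring.coeff P p 0 [^] Suc k)"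
    using p by (subst R.add_pow_ldistr) simp_all
  also have "\<dots> = [Suc (Suc k)] \<cdot> (up_ring.coeff P p 0 [^] Suc k)"
    using p R.add.nat_pow_Suc2[of "up_ring.coeff P p 0 [^] Suc k" "Suc k"] by simp
  finally show ?case .
qed

lemma coeff_mult_monom:
  assumes "p \<in> carrier P" "a \<in> carrier R"
  shows "up_ring.coeff P (p \<otimes>\<^bsub>P\<^esub> up_ring.monom P a n) (k + n) = up_ring.coeff P p k \<otimes> a"
  using coeff_monom_mult[of a p n k] assms
  by (simp add: P.m_comm R.m_comm del: coeff_mult)

lemma add_pow_monom:
  "a \<in> carrier R \<Longrightarrow> add_pow P (k::nat) (up_ring.monom P a n) = up_ring.monom P ([k] \<cdot> a) n"
  by (induction k) simp_all

end

text \<open>\<open>socle_relations\<close> applied in the quotient by I, where membership in I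
  becomes vanishing.\<close>

lemma (in cring) socle_relations_ideal:
  assumes I: "ideal I R"
    and cl [simp]: "x \<in> carrier R" "y \<in> carrier R" "s \<in> carrier R" "t \<in> carrier R"
    and xn: "x [^] (m + 2) \<in> I" and yn: "y [^] (m + 2) \<in> I"
    and F: "x \<otimes> y \<otimes> (x \<ominus> y) \<otimes> (s \<otimes> x \<ominus> t \<otimes> y) \<in> I"
  shows "x \<otimes> (s \<otimes> x [^] (2::nat) \<otimes> y [^] (m + 1)) \<in> I"
    and "y \<otimes> (s \<otimes> x [^] (2::nat) \<otimes> y [^] (m + 1)) \<in> I"
    and "geom s t (m + 1) \<otimes> (x [^] (2::nat) \<otimes> y [^] (m + 1)) \<in> I"
proof -
  interpret I: ideal I R by fact
  have z0: "\<zero>\<^bsub>R Quot I\<^esub> = I" by (simp add: FactRing_def)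
  have Q: "cring (R Quot I)" by (rule I.quotient_is_cring[OF is_cring])
  have q: "ring_hom_cring R (R Quot I) ((+>) I)"
    by (rule ring_hom_cringI[OF is_cring Q I.rcos_ring_hom])
  interpret Q: cring "R Quot I" by (rule Q)
  interpret q: ring_hom_cring R "R Quot I" "(+>) I" by (rule q)
  have zero: "u \<in> I \<longleftrightarrow> I +> u = \<zero>\<^bsub>R Quot I\<^esub>" if "u \<in> carrier R" for u
  proof -
    show ?thesis using z0 I.a_rcos_const[of u] I.a_rcos_self[OF that] by metis
  qed
  have hsub: "I +> (u \<ominus> v) = (I +> u) \<ominus>\<^bsub>R Quot I\<^esub> (I +> v)"
    if "u \<in> carrier R" "v \<in> carrier R" for u v
    using that by (simp add: minus_eq Q.minus_eq)
  have hgeom: "I +> geom s t j = Q.geom (I +> s) (I +> t) j" for j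
    by (induction j) simp_all
  note rel = Q.socle_relations[of "I +> x" "I +> y" "I +> s" "I +> t" m]
  have z: "(I +> x) [^]\<^bsub>R Quot I\<^esub> (m + 2) = \<zero>\<^bsub>R Quot I\<^esub>"
    "(I +> y) [^]\<^bsub>R Quot I\<^esub> (m + 2) = \<zero>\<^bsub>R Quot I\<^esub>"
    "(I +> x) \<otimes>\<^bsub>R Quot I\<^esub> (I +> y) \<otimes>\<^bsub>R Quot I\<^esub> ((I +> x) \<ominus>\<^bsub>R Quot I\<^esub> (I +> y)) \<otimes>\<^bsub>R Quot I\<^esub>
      ((I +> s) \<otimes>\<^bsub>R Quot I\<^esub> (I +> x) \<ominus>\<^bsub>R Quot I\<^esub> (I +> t) \<otimes>\<^bsub>R Quot I\<^esub> (I +> y)) = \<zero>\<^bsub>R Quot I\<^esub>"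
    using xn yn F by (simp_all only: zero cl nat_pow_closed m_closed minus_closed q.hom_pow q.hom_mult hsub)
  show "x \<otimes> (s \<otimes> x [^] (2::nat) \<otimes> y [^] (m + 1)) \<in> I"
    and "y \<otimes> (s \<otimes> x [^] (2::nat) \<otimes> y [^] (m + 1)) \<in> I"
    and "geom s t (m + 1) \<otimes> (x [^] (2::nat) \<otimes> y [^] (m + 1)) \<in> I"
    using rel[OF _ _ _ _ z] cl
    by (simp_all only: zero nat_pow_closed m_closed q.hom_pow q.hom_mult geom_closed hgeom q.hom_closed)
qed

context four_generated
begin

definition F where
  "F = x \<otimes> y \<otimes> (x \<ominus> y) \<otimes> (s \<otimes> x \<ominus> t \<otimes> y)"

lemma F_closed [simp]: "F \<in> carrier S"
  by (simp add: F_def)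

text \<open>The preimage in S of the ideal of R generated by x^n and y^n. The coefficients are
  explicit because they are later restricted to lines.\<close>

definition J :: "nat \<Rightarrow> 'a set" where
  "J n = {p \<otimes> x [^] n \<oplus> q \<otimes> y [^] n \<oplus> r \<otimes> F | p q r. p \<in> carrier S \<and> q \<in> carrier S \<and> r \<in> carrier S}"

lemma ideal_J: "ideal (J n) S"
proof -
  have "J n = PIdl (x [^] n) <+> PIdl (y [^] n) <+> PIdl F"
    by (fastforce simp: J_def set_add_def' cgenideal_def)
  then show ?thesis by (simp add: add_ideals cgenideal_ideal)
qed

text \<open>The extra factors h and g provide for the cofactors v and v' in
  \<open>annihilator_eq_kernel\<close>, where the annihilated element is v e and not e.\<close>

lemma J_annihilates:
  assumes h: "h \<in> carrier S" and g: "g \<in> carrier S"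
  shows "u \<in> xy_ideal \<Longrightarrow> u \<otimes> (h \<otimes> (s \<otimes> x [^] (2::nat) \<otimes> y [^] (m + 1))) \<in> J (m + 2)"
    and "g \<otimes> (geom s t (m + 1) \<otimes> (s \<otimes> x [^] (2::nat) \<otimes> y [^] (m + 1))) \<in> J (m + 2)"
proof -
  have I: "ideal (J (m + 2)) S" by (rule ideal_J)
  have "x [^] (m + 2) \<in> J (m + 2)"
    unfolding J_def by (rule CollectI, rule exI[of _ \<one>], rule exI[of _ \<zero>], rule exI[of _ \<zero>]) simp
  moreover have "y [^] (m + 2) \<in> J (m + 2)"
    unfolding J_def by (rule CollectI, rule exI[of _ \<zero>], rule exI[of _ \<one>], rule exI[of _ \<zero>]) simp
  moreover have "F \<in> J (m + 2)"
    unfolding J_def by (rule CollectI, rule exI[of _ \<zero>], rule exI[of _ \<zero>], rule exI[of _ \<one>]) simp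
  ultimately have rel: "x \<otimes> (s \<otimes> x [^] (2::nat) \<otimes> y [^] (m + 1)) \<in> J (m + 2)"
    "y \<otimes> (s \<otimes> x [^] (2::nat) \<otimes> y [^] (m + 1)) \<in> J (m + 2)"
    "geom s t (m + 1) \<otimes> (x [^] (2::nat) \<otimes> y [^] (m + 1)) \<in> J (m + 2)"
    using socle_relations_ideal[OF I gens_closed] unfolding F_def by blast+
  define e where "e = s \<otimes> x [^] (2::nat) \<otimes> y [^] (m + 1)"
  have ec [simp]: "e \<in> carrier S" by (simp add: e_def)
  have "g \<otimes> (geom s t (m + 1) \<otimes> (s \<otimes> x [^] (2::nat) \<otimes> y [^] (m + 1)))
      = (g \<otimes> s) \<otimes> (geom s t (m + 1) \<otimes> (x [^] (2::nat) \<otimes> y [^] (m + 1)))"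
    using g by (simp add: m_ac del: geom.simps nat_pow_Suc)
  then show "g \<otimes> (geom s t (m + 1) \<otimes> (s \<otimes> x [^] (2::nat) \<otimes> y [^] (m + 1))) \<in> J (m + 2)"
    using ideal.I_l_closed[OF I rel(3), of "g \<otimes> s"] g by simp
  show "u \<otimes> (h \<otimes> (s \<otimes> x [^] (2::nat) \<otimes> y [^] (m + 1))) \<in> J (m + 2)" if u: "u \<in> xy_ideal"
  proof -
    obtain p q where pq: "p \<in> carrier S" "q \<in> carrier S" "u = x \<otimes> p \<oplus> y \<otimes> q"
      using u by (auto simp: xy_ideal_def)
    have "u \<otimes> (h \<otimes> e) = p \<otimes> h \<otimes> (x \<otimes> e) \<oplus> q \<otimes> h \<otimes> (y \<otimes> e)"
      using pq h by (simp add: l_distr r_distr m_ac)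
    moreover have "p \<otimes> h \<otimes> (x \<otimes> e) \<in> J (m + 2)" "q \<otimes> h \<otimes> (y \<otimes> e) \<in> J (m + 2)"
      using rel pq h ideal.I_l_closed[OF I] by (simp_all add: e_def)
    ultimately show ?thesis
      using additive_subgroup.a_closed[OF ideal.axioms(1)[OF I]] by (simp add: e_def)
  qed
qed

end

section \<open>The annihilator of v e is the kernel of \<phi>\<close>

text \<open>Here n = m + 2 and N = m + 1. In \<open>hom_exists\<close> the images of x, y and t are
  free while s and the constants follow \<phi>. It serves twice: x and y move along a line with t
  fixed, or x and y are zero and t is displaced to first order.\<close>

locale four_generated_unity = four_generated_root S K c x y s t L \<iota> \<zeta> \<phi>
  for S (structure) and K :: "('k, 'm) ring_scheme" and c x y s t
    and L :: "('l, 'n) ring_scheme" and \<iota> \<zeta> \<phi> +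
  fixes m :: nat
  assumes hom_exists: "\<And>\<xi> \<eta> \<tau>. \<lbrakk>\<xi> \<in> carrier (UP (UP L)); \<eta> \<in> carrier (UP (UP L)); \<tau> \<in> carrier (UP (UP L))\<rbrakk> \<Longrightarrow>
      \<exists>h \<in> ring_hom S (UP (UP L)). h x = \<xi> \<and> h y = \<eta> \<and> h s = up_ring.monom (UP (UP L)) (\<phi> s) 0
        \<and> h t = \<tau> \<and> (\<forall>a \<in> carrier K. h (c a) = up_ring.monom (UP (UP L)) (\<phi> (c a)) 0)"
    and unity: "\<zeta> [^]\<^bsub>L\<^esub> (m + 1) = \<one>\<^bsub>L\<^esub>" and not_one: "\<zeta> \<noteq> \<one>\<^bsub>L\<^esub>"
    and order_invertible: "add_pow L (m + 1) \<one>\<^bsub>L\<^esub> \<noteq> \<zero>\<^bsub>L\<^esub>"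
begin

interpretation B: UP_domain L "UP L"
  by unfold_locales simp
interpretation C: UP_domain "UP L" "UP (UP L)"
  by unfold_locales simp
interpretation \<phi>: ring_hom_cring S "UP L" \<phi>
  by (rule ring_hom_cringI[OF is_cring B.UP_cring \<phi>_hom])

lemma \<phi>_vars_closed [simp]: "\<phi> s \<in> carrier (UP L)" "\<phi> t \<in> carrier (UP L)"
  by simp_all

text \<open>Restriction to the line through the origin of the (x, y)-plane in direction (a, b), with
  s and t specialised by \<phi>. The outer variable is the parameter of the line.\<close>

definition line_hom where
  "line_hom a b h \<longleftrightarrow> h \<in> ring_hom S (UP (UP L))
    \<and> h x = up_ring.monom (UP (UP L)) a 1 \<and> h y = up_ring.monom (UP (UP L)) b 1
    \<and> h s = up_ring.monom (UP (UP L)) (\<phi> s) 0 \<and> h t = up_ring.monom (UP (UP L)) (\<phi> t) 0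
    \<and> (\<forall>a \<in> carrier K. h (c a) = up_ring.monom (UP (UP L)) (\<phi> (c a)) 0)"

lemma line_hom_exists:
  assumes "a \<in> carrier (UP L)" "b \<in> carrier (UP L)"
  shows "\<exists>h. line_hom a b h"
  using hom_exists[of "up_ring.monom (UP (UP L)) a 1" "up_ring.monom (UP (UP L)) b 1"
      "up_ring.monom (UP (UP L)) (\<phi> t) 0"] assms
  unfolding line_hom_def by fastforce

lemma line_hom_ring_hom_cring: "line_hom a b h \<Longrightarrow> ring_hom_cring S (UP (UP L)) h"
  by (rule ring_hom_cringI[OF is_cring C.UP_cring]) (simp add: line_hom_def)

text \<open>Along every line the constant term is the value at the origin, and the linear term is a
  directional derivative there, hence linear in (a, b). The maps h1 and h2 are the two coordinate
  axes.\<close>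

lemma line_hom_coeffs:
  assumes h: "line_hom a b h" and h1: "line_hom \<one>\<^bsub>UP L\<^esub> \<zero>\<^bsub>UP L\<^esub> h1" and h2: "line_hom \<zero>\<^bsub>UP L\<^esub> \<one>\<^bsub>UP L\<^esub> h2"
    and [simp]: "a \<in> carrier (UP L)" "b \<in> carrier (UP L)" and p: "p \<in> carrier S"
  shows "up_ring.coeff (UP (UP L)) (h p) 0 = \<phi> p \<and>
    up_ring.coeff (UP (UP L)) (h p) (Suc 0) =
      a \<otimes>\<^bsub>UP L\<^esub> up_ring.coeff (UP (UP L)) (h1 p) (Suc 0)
      \<oplus>\<^bsub>UP L\<^esub> b \<otimes>\<^bsub>UP L\<^esub> up_ring.coeff (UP (UP L)) (h2 p) (Suc 0)"
proof -
  interpret h: ring_hom_cring S "UP (UP L)" h using line_hom_ring_hom_cring[OF h] .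
  interpret h1: ring_hom_cring S "UP (UP L)" h1 using line_hom_ring_hom_cring[OF h1] .
  interpret h2: ring_hom_cring S "UP (UP L)" h2 using line_hom_ring_hom_cring[OF h2] .
  \<comment> \<open>The constant terms along the axes are included because the product rule for
    linear terms uses them.\<close>
  define Q where "Q = (\<lambda>p. up_ring.coeff (UP (UP L)) (h p) 0 = \<phi> p
    \<and> up_ring.coeff (UP (UP L)) (h1 p) 0 = \<phi> p \<and> up_ring.coeff (UP (UP L)) (h2 p) 0 = \<phi> p \<and>
    up_ring.coeff (UP (UP L)) (h p) (Suc 0) =
      a \<otimes>\<^bsub>UP L\<^esub> up_ring.coeff (UP (UP L)) (h1 p) (Suc 0)
      \<oplus>\<^bsub>UP L\<^esub> b \<otimes>\<^bsub>UP L\<^esub> up_ring.coeff (UP (UP L)) (h2 p) (Suc 0))"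
  note gens = h[unfolded line_hom_def] h1[unfolded line_hom_def] h2[unfolded line_hom_def]
  have "Q p"
    using p
  proof (induction p rule: gen_induct')
    case (const a)
    then show ?case unfolding Q_def using gens by simp
  next
    case (add p q)
    then show ?case unfolding Q_def
      by (simp add: B.r_distr B.a_ac)
  next
    case (x p)
    then show ?case unfolding Q_def using gens
      by (simp add: C.coeff_mult_0 C.coeff_mult_1 \<phi>_x del: C.coeff_mult)
  next
    case (y p)
    then show ?case unfolding Q_def using gens
      by (simp add: C.coeff_mult_0 C.coeff_mult_1 \<phi>_y del: C.coeff_mult)
  next
    case (s p)
    then show ?case unfolding Q_def using gens
      by (simp add: C.coeff_mult_0 C.coeff_mult_1 B.r_distr B.m_ac del: C.coeff_mult)
  next
    case (t p)
    then show ?case unfolding Q_def using gens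
      by (simp add: C.coeff_mult_0 C.coeff_mult_1 B.r_distr B.m_ac del: C.coeff_mult)
  qed
  then show ?thesis by (simp add: Q_def)
qed

text \<open>This is the coefficient at exponent m + 3 = n + 1 of the restricted identity. The left
  monomial has exactly this degree, so g enters through its constant term; x^n and y^n have degree
  one less, so p and q enter through their linear terms; F restricts to zero.\<close>

lemma line_hom_eq:
  assumes h: "line_hom a b h"
    and a [simp]: "a \<in> carrier (UP L)" and b [simp]: "b \<in> carrier (UP L)"
    and pqr [simp]: "p \<in> carrier S" "q \<in> carrier S" "r \<in> carrier S" "g \<in> carrier S"
    and F: "h F = \<zero>\<^bsub>UP (UP L)\<^esub>" and \<phi>: "up_ring.coeff (UP (UP L)) (h g) 0 = \<phi> g"
    and eq: "g \<otimes> (x [^] (2::nat) \<otimes> y [^] (m + 1)) = p \<otimes> x [^] (m + 2) \<oplus> q \<otimes> y [^] (m + 2) \<oplus> r \<otimes> F"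
  shows "\<phi> g \<otimes>\<^bsub>UP L\<^esub> (a [^]\<^bsub>UP L\<^esub> (2::nat) \<otimes>\<^bsub>UP L\<^esub> b [^]\<^bsub>UP L\<^esub> (m + 1))
    = up_ring.coeff (UP (UP L)) (h p) (Suc 0) \<otimes>\<^bsub>UP L\<^esub> a [^]\<^bsub>UP L\<^esub> (m + 2)
      \<oplus>\<^bsub>UP L\<^esub> up_ring.coeff (UP (UP L)) (h q) (Suc 0) \<otimes>\<^bsub>UP L\<^esub> b [^]\<^bsub>UP L\<^esub> (m + 2)"
proof -
  interpret h: ring_hom_cring S "UP (UP L)" h using line_hom_ring_hom_cring[OF h] .
  have hx: "h (x [^] (k::nat)) = up_ring.monom (UP (UP L)) (a [^]\<^bsub>UP L\<^esub> k) k"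
    and hy: "h (y [^] (k::nat)) = up_ring.monom (UP (UP L)) (b [^]\<^bsub>UP L\<^esub> k) k" for k
    using h by (simp_all add: line_hom_def C.monom_pow)
  have hxy: "h (x [^] (2::nat) \<otimes> y [^] (m + 1)) =
      up_ring.monom (UP (UP L)) (a [^]\<^bsub>UP L\<^esub> (2::nat) \<otimes>\<^bsub>UP L\<^esub> b [^]\<^bsub>UP L\<^esub> (m + 1)) (2 + (m + 1))"
    by (simp only: h.hom_mult nat_pow_closed gens_closed hx hy C.monom_mult B.nat_pow_closed a b)
  have "h g \<otimes>\<^bsub>UP (UP L)\<^esub> up_ring.monom (UP (UP L)) (a [^]\<^bsub>UP L\<^esub> (2::nat) \<otimes>\<^bsub>UP L\<^esub> b [^]\<^bsub>UP L\<^esub> (m + 1)) (2 + (m + 1))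
    = h (g \<otimes> (x [^] (2::nat) \<otimes> y [^] (m + 1)))"
    by (simp only: h.hom_mult m_closed nat_pow_closed gens_closed pqr hxy[symmetric])
  also have "\<dots> = h p \<otimes>\<^bsub>UP (UP L)\<^esub> up_ring.monom (UP (UP L)) (a [^]\<^bsub>UP L\<^esub> (m + 2)) (m + 2)
      \<oplus>\<^bsub>UP (UP L)\<^esub> h q \<otimes>\<^bsub>UP (UP L)\<^esub> up_ring.monom (UP (UP L)) (b [^]\<^bsub>UP L\<^esub> (m + 2)) (m + 2)"
    unfolding eq
    by (simp only: h.hom_mult h.hom_add m_closed a_closed nat_pow_closed gens_closed pqr F_closed hx hy F
      C.r_null h.hom_closed C.r_zero C.m_closed C.a_closed C.monom_closed B.nat_pow_closed a b)
  finally have "up_ring.coeff (UP (UP L)) (h g \<otimes>\<^bsub>UP (UP L)\<^esub> up_ring.monom (UP (UP L)) (a [^]\<^bsub>UP L\<^esub> (2::nat) \<otimes>\<^bsub>UP L\<^esub> b [^]\<^bsub>UP L\<^esub> (m + 1)) (2 + (m + 1))) (0 + (2 + (m + 1)))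
    = up_ring.coeff (UP (UP L)) (h p \<otimes>\<^bsub>UP (UP L)\<^esub> up_ring.monom (UP (UP L)) (a [^]\<^bsub>UP L\<^esub> (m + 2)) (m + 2)) (Suc 0 + (m + 2))
    \<oplus>\<^bsub>UP L\<^esub> up_ring.coeff (UP (UP L)) (h q \<otimes>\<^bsub>UP (UP L)\<^esub> up_ring.monom (UP (UP L)) (b [^]\<^bsub>UP L\<^esub> (m + 2)) (m + 2)) (Suc 0 + (m + 2))"
    by (simp del: C.coeff_mult B.nat_pow_Suc C.monom_mult)
  then show ?thesis
    by (simp only: C.coeff_mult_monom h.hom_closed pqr B.nat_pow_closed B.m_closed a b \<phi>)
qed

text \<open>The four lines give four linear equations in the first derivatives of p and q at the
  origin. They are consistent only if (\<zeta>^2 - \<zeta>) \<phi>(g) = 0.\<close>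

lemma annihilator_subset_kernel:
  assumes g [simp]: "g \<in> carrier S" and mem: "g \<otimes> (x [^] (2::nat) \<otimes> y [^] (m + 1)) \<in> J (m + 2)"
  shows "\<phi> g = \<zero>\<^bsub>UP L\<^esub>"
proof -
  obtain p q r where pqr [simp]: "p \<in> carrier S" "q \<in> carrier S" "r \<in> carrier S"
    and eq: "g \<otimes> (x [^] (2::nat) \<otimes> y [^] (m + 1)) = p \<otimes> x [^] (m + 2) \<oplus> q \<otimes> y [^] (m + 2) \<oplus> r \<otimes> F"
    using mem unfolding J_def by blast
  define z where "z = up_ring.monom (UP L) \<zeta> 0"
  have z [simp]: "z \<in> carrier (UP L)" by (simp add: z_def)
  obtain h1 where h1: "line_hom \<one>\<^bsub>UP L\<^esub> \<zero>\<^bsub>UP L\<^esub> h1" using line_hom_exists by blast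
  obtain h2 where h2: "line_hom \<zero>\<^bsub>UP L\<^esub> \<one>\<^bsub>UP L\<^esub> h2" using line_hom_exists by blast
  obtain h3 where h3: "line_hom \<one>\<^bsub>UP L\<^esub> \<one>\<^bsub>UP L\<^esub> h3" using line_hom_exists by blast
  obtain h4 where h4: "line_hom z \<one>\<^bsub>UP L\<^esub> h4" using line_hom_exists z by blast
  interpret h1: ring_hom_cring S "UP (UP L)" h1 using line_hom_ring_hom_cring[OF h1] .
  interpret h2: ring_hom_cring S "UP (UP L)" h2 using line_hom_ring_hom_cring[OF h2] .
  interpret h3: ring_hom_cring S "UP (UP L)" h3 using line_hom_ring_hom_cring[OF h3] .
  interpret h4: ring_hom_cring S "UP (UP L)" h4 using line_hom_ring_hom_cring[OF h4] .
  have F1: "h1 F = \<zero>\<^bsub>UP (UP L)\<^esub>" using h1 by (simp add: F_def line_hom_def minus_eq)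
  have F2: "h2 F = \<zero>\<^bsub>UP (UP L)\<^esub>" using h2 by (simp add: F_def line_hom_def minus_eq)
  have F3: "h3 F = \<zero>\<^bsub>UP (UP L)\<^esub>" using h3 by (simp add: F_def line_hom_def minus_eq C.r_neg)
  \<comment> \<open>On this line s x and t y both become \<zeta> w times the parameter.\<close>
  have F4: "h4 F = \<zero>\<^bsub>UP (UP L)\<^esub>"
  proof -
    have "up_ring.monom (UP (UP L)) (\<phi> s) 0 \<otimes>\<^bsub>UP (UP L)\<^esub> up_ring.monom (UP (UP L)) z 1
      = up_ring.monom (UP (UP L)) (\<phi> s \<otimes>\<^bsub>UP L\<^esub> z) (0 + 1)"
      by (rule C.monom_mult[symmetric]) simp_all
    also have "\<phi> s \<otimes>\<^bsub>UP L\<^esub> z = up_ring.monom (UP L) (\<one>\<^bsub>L\<^esub> \<otimes>\<^bsub>L\<^esub> \<zeta>) (1 + 0)"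
      unfolding \<phi>_s z_def by (rule B.monom_mult[symmetric]) simp_all
    also have "\<dots> = \<phi> t" by (simp add: \<phi>_t)
    also have "up_ring.monom (UP (UP L)) (\<phi> t) (0 + 1) = up_ring.monom (UP (UP L)) (\<phi> t \<otimes>\<^bsub>UP L\<^esub> \<one>\<^bsub>UP L\<^esub>) (0 + 1)"
      by simp
    also have "\<dots> = up_ring.monom (UP (UP L)) (\<phi> t) 0 \<otimes>\<^bsub>UP (UP L)\<^esub> up_ring.monom (UP (UP L)) \<one>\<^bsub>UP L\<^esub> 1"
      by (rule C.monom_mult) simp_all
    finally have *: "h4 (s \<otimes> x \<ominus> t \<otimes> y) = \<zero>\<^bsub>UP (UP L)\<^esub>"
      using h4 by (simp add: line_hom_def minus_eq C.r_neg)
    have "h4 F = h4 (x \<otimes> y \<otimes> (x \<ominus> y)) \<otimes>\<^bsub>UP (UP L)\<^esub> h4 (s \<otimes> x \<ominus> t \<otimes> y)"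
      unfolding F_def by (rule h4.hom_mult) simp_all
    then show ?thesis by (simp only: *) (rule C.r_null, rule h4.hom_closed, simp)
  qed
  note co = line_hom_coeffs[OF _ h1 h2]
  note C3 = co[OF h3] and C4 = co[OF h4]
  define D1 D2 E1 E2 where
    "D1 = up_ring.coeff (UP (UP L)) (h1 p) (Suc 0)" and "D2 = up_ring.coeff (UP (UP L)) (h2 p) (Suc 0)" and
    "E1 = up_ring.coeff (UP (UP L)) (h1 q) (Suc 0)" and "E2 = up_ring.coeff (UP (UP L)) (h2 q) (Suc 0)"
  have [simp]: "D1 \<in> carrier (UP L)" "D2 \<in> carrier (UP L)" "E1 \<in> carrier (UP L)" "E2 \<in> carrier (UP L)"
    by (simp_all add: D1_def D2_def E1_def E2_def)
  \<comment> \<open>On each axis the left side vanishes, since x^2 y^(m+1) contains both variables;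
    one derivative is left over and must be zero.\<close>
  have D1: "D1 = \<zero>\<^bsub>UP L\<^esub>"
    using line_hom_eq[OF h1 _ _ pqr g F1 _ eq] co[OF h1] by (simp add: D1_def[symmetric])
  have E2: "E2 = \<zero>\<^bsub>UP L\<^esub>"
    using line_hom_eq[OF h2 _ _ pqr g F2 _ eq] co[OF h2] by (simp add: E2_def[symmetric] numeral_2_eq_2)
  have 3: "\<phi> g = D2 \<oplus>\<^bsub>UP L\<^esub> E1"
    using line_hom_eq[OF h3 _ _ pqr g F3 _ eq] C3
    by (simp add: D1_def[symmetric] D2_def[symmetric] E1_def[symmetric] E2_def[symmetric] D1 E2)
  have zn: "z [^]\<^bsub>UP L\<^esub> (m + 1) = \<one>\<^bsub>UP L\<^esub>"
    unfolding z_def by (simp only: B.monom_pow \<zeta>_closed unity) simp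
  \<comment> \<open>N = n - 1, so \<zeta>^n = \<zeta>. On the line x = \<zeta> y the right side is
    therefore \<zeta> (D2 + E1), which is \<zeta> \<phi>(g) by the equation from x = y, while the
    left side is \<zeta>^2 \<phi>(g).\<close>
  have zn2: "z [^]\<^bsub>UP L\<^esub> (m + 2) = z"
  proof -
    have "z [^]\<^bsub>UP L\<^esub> (m + 2) = z [^]\<^bsub>UP L\<^esub> (m + 1) \<otimes>\<^bsub>UP L\<^esub> z" by simp
    then show ?thesis unfolding zn by simp
  qed
  have "up_ring.coeff (UP (UP L)) (h4 p) (Suc 0) = D2"
    using C4[OF z _ pqr(1)] by (simp add: D1_def[symmetric] D2_def[symmetric] D1)
  moreover have "up_ring.coeff (UP (UP L)) (h4 q) (Suc 0) = z \<otimes>\<^bsub>UP L\<^esub> E1"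
    using C4[OF z _ pqr(2)] by (simp add: E1_def[symmetric] E2_def[symmetric] E2)
  moreover have "up_ring.coeff (UP (UP L)) (h4 g) 0 = \<phi> g"
    using C4[OF z _ g] by simp
  ultimately have "\<phi> g \<otimes>\<^bsub>UP L\<^esub> (z [^]\<^bsub>UP L\<^esub> (2::nat)) = D2 \<otimes>\<^bsub>UP L\<^esub> z \<oplus>\<^bsub>UP L\<^esub> z \<otimes>\<^bsub>UP L\<^esub> E1"
    using line_hom_eq[OF h4 z _ pqr g F4 _ eq] unfolding zn2 by simp
  also have "\<dots> = z \<otimes>\<^bsub>UP L\<^esub> \<phi> g"
    unfolding 3 by (simp add: B.r_distr B.m_comm)
  finally have "\<phi> g \<otimes>\<^bsub>UP L\<^esub> (z \<otimes>\<^bsub>UP L\<^esub> (z \<ominus>\<^bsub>UP L\<^esub> \<one>\<^bsub>UP L\<^esub>)) = \<zero>\<^bsub>UP L\<^esub>"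
    by (simp add: numeral_2_eq_2 B.r_distr B.minus_eq B.r_minus B.m_comm B.r_neg)
  moreover have "z \<noteq> \<zero>\<^bsub>UP L\<^esub>"
  proof
    assume "z = \<zero>\<^bsub>UP L\<^esub>"
    then show False using zn by simp
  qed
  moreover have "z \<ominus>\<^bsub>UP L\<^esub> \<one>\<^bsub>UP L\<^esub> \<noteq> \<zero>\<^bsub>UP L\<^esub>"
  proof
    assume "z \<ominus>\<^bsub>UP L\<^esub> \<one>\<^bsub>UP L\<^esub> = \<zero>\<^bsub>UP L\<^esub>"
    then have "up_ring.coeff (UP L) z 0 = up_ring.coeff (UP L) \<one>\<^bsub>UP L\<^esub> 0" by simp
    then show False using not_one by (simp add: z_def)
  qed
  ultimately show ?thesis using B.integral_iff by simp
qed

lemma \<phi>_minus: "u \<in> carrier S \<Longrightarrow> v \<in> carrier S \<Longrightarrow> \<phi> (u \<ominus> v) = \<phi> u \<ominus>\<^bsub>UP L\<^esub> \<phi> v"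
  by (simp add: minus_eq B.minus_eq)

lemma \<phi>_pow: "\<phi> (t [^] (k::nat)) = up_ring.monom (UP L) (\<zeta> [^]\<^bsub>L\<^esub> k) k"
  "\<phi> (s [^] (k::nat)) = up_ring.monom (UP L) \<one>\<^bsub>L\<^esub> k"
  by (simp_all add: \<phi>_t \<phi>_s B.monom_pow)

lemma \<phi>_diff_nonzero: "\<phi> t \<ominus>\<^bsub>UP L\<^esub> \<phi> s \<noteq> \<zero>\<^bsub>UP L\<^esub>"
proof
  assume "\<phi> t \<ominus>\<^bsub>UP L\<^esub> \<phi> s = \<zero>\<^bsub>UP L\<^esub>"
  then have "up_ring.coeff (UP L) (\<phi> t) 1 = up_ring.coeff (UP L) (\<phi> s) 1" by simp
  then show False using not_one by (simp add: \<phi>_t \<phi>_s)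
qed

text \<open>(t - s) times the geometric sum maps to (\<zeta>^N - 1) w^N = 0, and t - s maps to a
  nonzero element because \<zeta> is not 1.\<close>

lemma \<phi>_geom: "\<phi> (geom s t (m + 1)) = \<zero>\<^bsub>UP L\<^esub>"
proof -
  have "(\<phi> t \<ominus>\<^bsub>UP L\<^esub> \<phi> s) \<otimes>\<^bsub>UP L\<^esub> \<phi> (geom s t (m + 1)) = \<phi> ((t \<ominus> s) \<otimes> geom s t (m + 1))"
    by (simp add: \<phi>_minus del: geom.simps)
  also have "\<dots> = \<phi> (t [^] (m + 1)) \<ominus>\<^bsub>UP L\<^esub> \<phi> (s [^] (m + 1))"
    by (simp only: geom_mult gens_closed \<phi>_minus nat_pow_closed)
  also have "\<dots> = \<zero>\<^bsub>UP L\<^esub>"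
    unfolding \<phi>_pow unity by (simp add: B.minus_eq B.r_neg)
  finally show ?thesis using \<phi>_diff_nonzero B.integral_iff by simp
qed

text \<open>Since \<open>(t - s) geom s t N = t\<^sup>N - s\<^sup>N\<close> and \<open>N\<close> is invertible, \<open>\<zeta>\<close> is a simple root of
  \<open>geom 1 t N\<close>; this is seen by evaluating at \<open>\<zeta> + \<epsilon>\<close>, with \<open>\<epsilon>\<close> the variable of the outer
  polynomial ring.\<close>

lemma cofactor_nonzero:
  assumes v [simp]: "v \<in> carrier S" and f [simp]: "f \<in> carrier S" and w: "w \<in> xy_ideal"
    and eq: "geom s t (m + 1) = v \<otimes> f \<oplus> w" and \<phi>f: "\<phi> f = \<zero>\<^bsub>UP L\<^esub>"
  shows "\<phi> v \<noteq> \<zero>\<^bsub>UP L\<^esub>"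
proof
  assume \<phi>v: "\<phi> v = \<zero>\<^bsub>UP L\<^esub>"
  define T where "T = up_ring.monom (UP (UP L)) (\<phi> t) 0 \<oplus>\<^bsub>UP (UP L)\<^esub> up_ring.monom (UP (UP L)) \<one>\<^bsub>UP L\<^esub> 1"
  have T [simp]: "T \<in> carrier (UP (UP L))" by (simp add: T_def)
  have T0: "up_ring.coeff (UP (UP L)) T 0 = \<phi> t" and T1: "up_ring.coeff (UP (UP L)) T (Suc 0) = \<one>\<^bsub>UP L\<^esub>"
    by (simp_all add: T_def)
  obtain h where hom: "h \<in> ring_hom S (UP (UP L))" and hx: "h x = \<zero>\<^bsub>UP (UP L)\<^esub>" and hy: "h y = \<zero>\<^bsub>UP (UP L)\<^esub>"
    and hs: "h s = up_ring.monom (UP (UP L)) (\<phi> s) 0" and ht: "h t = T"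
    and hc: "\<And>a. a \<in> carrier K \<Longrightarrow> h (c a) = up_ring.monom (UP (UP L)) (\<phi> (c a)) 0"
    using hom_exists[OF C.zero_closed C.zero_closed T] by blast
  interpret h: ring_hom_cring S "UP (UP L)" h
    by (rule ring_hom_cringI[OF is_cring C.UP_cring hom])
  have c0: "up_ring.coeff (UP (UP L)) (h p) 0 = \<phi> p" if "p \<in> carrier S" for p
    using that
  proof (induction p rule: gen_induct')
    case (const a)
    then show ?case by (simp add: hc)
  next
    case (add p q)
    then show ?case by simp
  next
    case (x p)
    then show ?case by (simp add: hx \<phi>_x)
  next
    case (y p)
    then show ?case by (simp add: hy \<phi>_y)
  next
    case (s p)
    then show ?case by (simp add: hs C.coeff_mult_0 del: C.coeff_mult)
  next
    case (t p)
    then show ?case by (simp add: ht T0 C.coeff_mult_0 del: C.coeff_mult)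
  qed
  have hw: "h w = \<zero>\<^bsub>UP (UP L)\<^esub>" using w by (auto simp: xy_ideal_def hx hy)
  define G where "G = geom s t (m + 1)"
  have G [simp]: "G \<in> carrier S" by (simp add: G_def del: geom.simps)
  have "h G = h v \<otimes>\<^bsub>UP (UP L)\<^esub> h f"
    unfolding G_def eq using hw xy_ideal_closed[OF w] by simp
  \<comment> \<open>Both factors would have zero constant term, so their product has no linear
    term.\<close>
  then have G1: "up_ring.coeff (UP (UP L)) (h G) (Suc 0) = \<zero>\<^bsub>UP L\<^esub>"
    by (simp add: C.coeff_mult_1 c0 \<phi>f \<phi>v del: C.coeff_mult)
  have hm: "h (p \<ominus> q) = h p \<ominus>\<^bsub>UP (UP L)\<^esub> h q" if "p \<in> carrier S" "q \<in> carrier S" for p q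
    using that by (simp add: minus_eq C.minus_eq)
  have "up_ring.coeff (UP (UP L)) (h (t [^] (m + 1) \<ominus> s [^] (m + 1))) (Suc 0)
      = up_ring.coeff (UP (UP L)) (h (t \<ominus> s) \<otimes>\<^bsub>UP (UP L)\<^esub> h G) (Suc 0)"
    by (simp only: geom_mult[symmetric] G_def[symmetric] h.hom_mult G minus_closed gens_closed)
  also have "\<dots> = \<zero>\<^bsub>UP L\<^esub>"
    using \<phi>_geom[folded G_def] by (simp add: C.coeff_mult_1 c0 G1 del: C.coeff_mult)
  finally have z: "up_ring.coeff (UP (UP L)) (h (t [^] (m + 1) \<ominus> s [^] (m + 1))) (Suc 0) = \<zero>\<^bsub>UP L\<^esub>" .
  have hpow: "h (t [^] k) = T [^]\<^bsub>UP (UP L)\<^esub> k"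
    "h (s [^] k) = up_ring.monom (UP (UP L)) (\<phi> s [^]\<^bsub>UP L\<^esub> k) 0" for k :: nat
    by (simp_all add: hs ht C.monom_pow)
  \<comment> \<open>The same linear term computed directly: the power of s is constant, and the
    power of t contributes N (\<zeta> w)^m.\<close>
  have "up_ring.coeff (UP (UP L)) (h (t [^] (m + 1) \<ominus> s [^] (m + 1))) (Suc 0)
      = up_ring.coeff (UP (UP L)) (T [^]\<^bsub>UP (UP L)\<^esub> Suc m) (Suc 0) \<ominus>\<^bsub>UP L\<^esub> \<zero>\<^bsub>UP L\<^esub>"
    by (simp only: hm hpow nat_pow_closed gens_closed C.coeff_minus T C.nat_pow_closed C.monom_closed
        B.nat_pow_closed \<phi>_vars_closed C.coeff_monom Suc_eq_plus1[symmetric]) simp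
  also have "\<dots> = add_pow (UP L) (Suc m) (\<phi> t [^]\<^bsub>UP L\<^esub> m) \<ominus>\<^bsub>UP L\<^esub> \<zero>\<^bsub>UP L\<^esub>"
    by (simp only: C.coeff_pow_1[OF T T1] T0)
  also have "\<dots> = add_pow (UP L) (Suc m) (\<phi> t [^]\<^bsub>UP L\<^esub> m)"
    by (simp add: B.minus_eq)
  finally have "add_pow (UP L) (Suc m) (\<phi> t [^]\<^bsub>UP L\<^esub> m) = \<zero>\<^bsub>UP L\<^esub>"
    unfolding z by simp
  then have "add_pow (UP L) (Suc m) (up_ring.monom (UP L) (\<zeta> [^]\<^bsub>L\<^esub> m) m) = \<zero>\<^bsub>UP L\<^esub>"
    using \<phi>_pow(1)[of m] by simp
  then have "up_ring.coeff (UP L) (up_ring.monom (UP L) (add_pow L (Suc m) (\<zeta> [^]\<^bsub>L\<^esub> m)) m) m = \<zero>\<^bsub>L\<^esub>"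
    by (simp only: B.add_pow_monom L.nat_pow_closed \<zeta>_closed B.coeff_zero)
  then have "add_pow L (Suc m) (\<zeta> [^]\<^bsub>L\<^esub> m) = \<zero>\<^bsub>L\<^esub>"
    by (simp del: L.add.nat_pow_Suc)
  \<comment> \<open>One more factor \<zeta> completes \<zeta>^m to \<zeta>^N = 1 and leaves N = 0 in
    L.\<close>
  then have "add_pow L (Suc m) (\<zeta> [^]\<^bsub>L\<^esub> m) \<otimes>\<^bsub>L\<^esub> \<zeta> = \<zero>\<^bsub>L\<^esub>"
    by simp
  then have "add_pow L (Suc m) (\<zeta> [^]\<^bsub>L\<^esub> m \<otimes>\<^bsub>L\<^esub> \<zeta>) = \<zero>\<^bsub>L\<^esub>"
    by (simp only: L.add_pow_ldistr L.nat_pow_closed \<zeta>_closed)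
  then show False using unity order_invertible by simp
qed

text \<open>The witness is v e. The decomposition yields G = v f + w with w in (x, y); w is carried
  along instead of being shown to vanish, since it annihilates e modulo J anyway.\<close>

lemma annihilator_eq_kernel:
  "\<exists>a \<in> carrier S. \<forall>r \<in> carrier S. r \<otimes> a \<in> J (m + 2) \<longleftrightarrow> \<phi> r = \<zero>\<^bsub>UP L\<^esub>"
proof -
  have "\<phi> (geom s t (Suc m)) = \<zero>\<^bsub>UP L\<^esub>" using \<phi>_geom by (simp del: geom.simps)
  then obtain d f where f: "min_form d f" using min_form_exists by blast
  have fc [simp]: "f \<in> carrier S" and \<phi>f: "\<phi> f = \<zero>\<^bsub>UP L\<^esub>"
    using min_form_closed[OF f] f by (auto simp: min_form_def)
  obtain v w where v [simp]: "v \<in> carrier S" and w: "w \<in> xy_ideal"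
    and eq: "geom s t (m + 1) = v \<otimes> f \<oplus> w"
    using kernel_decomposition[OF f _ \<phi>_geom] by auto
  have wc [simp]: "w \<in> carrier S" using xy_ideal_closed[OF w] .
  have \<phi>v: "\<phi> v \<noteq> \<zero>\<^bsub>UP L\<^esub>" using cofactor_nonzero[OF v fc w eq \<phi>f] .
  define e where "e = s \<otimes> x [^] (2::nat) \<otimes> y [^] (m + 1)"
  have e [simp]: "e \<in> carrier S" by (simp add: e_def)
  interpret J: ideal "J (m + 2)" S by (rule ideal_J)
  have "r \<otimes> (v \<otimes> e) \<in> J (m + 2) \<longleftrightarrow> \<phi> r = \<zero>\<^bsub>UP L\<^esub>" if r [simp]: "r \<in> carrier S" for r
  proof
    assume "r \<otimes> (v \<otimes> e) \<in> J (m + 2)"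
    \<comment> \<open>With g = r v s the previous lemma gives \<phi>(r) \<phi>(v) \<phi>(s) = 0, and
      the last two factors are nonzero.\<close>
    moreover have "r \<otimes> (v \<otimes> e) = (r \<otimes> v \<otimes> s) \<otimes> (x [^] (2::nat) \<otimes> y [^] (m + 1))"
      by (simp add: e_def m_assoc del: nat_pow_Suc)
    ultimately have "\<phi> (r \<otimes> v \<otimes> s) = \<zero>\<^bsub>UP L\<^esub>"
      using annihilator_subset_kernel[of "r \<otimes> v \<otimes> s"] by simp
    then show "\<phi> r = \<zero>\<^bsub>UP L\<^esub>"
      using \<phi>v \<phi>_s_pow_nonzero[of 1] by (simp add: B.integral_iff)
  next
    assume "\<phi> r = \<zero>\<^bsub>UP L\<^esub>"
    then obtain v' w' where v' [simp]: "v' \<in> carrier S" and w': "w' \<in> xy_ideal" and r': "r = v' \<otimes> f \<oplus> w'"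
      using kernel_decomposition[OF f r] by blast
    have w'c [simp]: "w' \<in> carrier S" using xy_ideal_closed[OF w'] .
    have 1: "v' \<otimes> (geom s t (m + 1) \<otimes> e) \<in> J (m + 2)"
      unfolding e_def by (rule J_annihilates(2)[OF one_closed v'])
    have 2: "w \<otimes> (v' \<otimes> e) \<in> J (m + 2)" "w' \<otimes> (v \<otimes> e) \<in> J (m + 2)"
      unfolding e_def by (rule J_annihilates(1)[OF v' one_closed w], rule J_annihilates(1)[OF v one_closed w'])
    have "r \<otimes> (v \<otimes> e) = v' \<otimes> ((v \<otimes> f \<oplus> w) \<otimes> e) \<oplus> \<ominus> (w \<otimes> (v' \<otimes> e)) \<oplus> w' \<otimes> (v \<otimes> e)"
    proof -
      have "v' \<otimes> ((v \<otimes> f \<oplus> w) \<otimes> e) = (v' \<otimes> f) \<otimes> (v \<otimes> e) \<oplus> w \<otimes> (v' \<otimes> e)"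
        by (simp add: l_distr r_distr m_ac)
      then show ?thesis
        unfolding r' by (simp add: l_distr a_assoc r_neg1 r_neg)
    qed
    then show "r \<otimes> (v \<otimes> e) \<in> J (m + 2)"
      using J.a_closed[OF J.a_closed[OF 1[unfolded eq] J.a_inv_closed[OF 2(1)]] 2(2)] by (simp only:)
  qed
  then show ?thesis by (intro bexI[of _ "v \<otimes> e"]) auto
qed

end

section \<open>Counting roots of unity\<close>

lemma (in cring) geom_same:
  "z \<in> carrier R \<Longrightarrow> geom z z (Suc j) = [Suc j] \<cdot> (z [^] j)"
proof (induction j)
  case (Suc j)
  have "geom z z (Suc (Suc j)) = z \<otimes> ([Suc j] \<cdot> (z [^] j)) \<oplus> z [^] Suc j"
    using Suc by (simp only: geom.simps(2)[of z z "Suc j"])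
  also have "\<dots> = [Suc j] \<cdot> (z \<otimes> z [^] j) \<oplus> z [^] Suc j"
    using Suc.prems by (subst add_pow_rdistr) simp_all
  also have "z \<otimes> z [^] j = z [^] Suc j" using Suc.prems by (simp add: m_comm)
  finally show ?case by simp
qed simp

lemma (in ring_hom_cring) hom_geom:
  "u \<in> carrier R \<Longrightarrow> v \<in> carrier R \<Longrightarrow> h (R.geom u v j) = S.geom (h u) (h v) j"
  by (induction j) simp_all

text \<open>X^N - 1 splits, so it has N roots with multiplicity. A root z is simple because X^N -
  z^N is X - z times a geometric sum whose value at z is N z^(N-1), which is nonzero.\<close>

lemma (in algebraically_closed) card_roots_of_unity:
  assumes N: "N > 0" and inv: "[N] \<cdot> \<one> \<noteq> \<zero>"
  shows "card {z \<in> carrier L. z [^] N = \<one>} = N" and "finite {z \<in> carrier L. z [^] N = \<one>}"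
proof -
  interpret P: domain "poly_ring L" by (rule univ_poly_is_domain[OF carrier_is_subring])
  obtain j where j: "N = Suc j" using N by (cases N) auto
  define p where "p = X [^]\<^bsub>poly_ring L\<^esub> N \<ominus>\<^bsub>poly_ring L\<^esub> \<one>\<^bsub>poly_ring L\<^esub>"
  have X [simp]: "X \<in> carrier (poly_ring L)" by (rule var_closed(1)[OF carrier_is_subring])
  have p [simp]: "p \<in> carrier (poly_ring L)" by (simp add: p_def)
  have ev: "ring_hom_cring (poly_ring L) L (\<lambda>p. eval p z)" if "z \<in> carrier L" for z
    using eval_cring_hom[OF carrier_is_subring that] .
  have evp: "eval p z = z [^] N \<ominus> \<one>" if z: "z \<in> carrier L" for z
  proof -
    interpret e: ring_hom_cring "poly_ring L" L "\<lambda>p. eval p z" by (rule ev[OF z])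
    show ?thesis using e.hom_one e.hom_pow[OF X, of N] eval_var[OF z] z
      by (simp add: p_def P.minus_eq minus_eq del: e.hom_one)
  qed
  have deg: "degree p = N"
  proof -
    have "X [^]\<^bsub>poly_ring L\<^esub> N = monom \<one> N" using unitary_monom_eq_var_pow[OF carrier_is_subring] by simp
    moreover have "degree (\<ominus>\<^bsub>poly_ring L\<^esub> \<one>\<^bsub>poly_ring L\<^esub>) = 0"
      using univ_poly_a_inv_degree[OF carrier_is_subring P.one_closed] by (simp add: univ_poly_one)
    ultimately show ?thesis
      unfolding p_def P.minus_eq univ_poly_add
      using poly_add_degree_eq[OF carrier_is_subring, of "monom \<one> N" "\<ominus>\<^bsub>poly_ring L\<^esub> \<one>\<^bsub>poly_ring L\<^esub>"] N
        X P.one_closed P.nat_pow_closed[OF X, of N]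
      by (simp add: monom_def univ_poly_carrier)
  qed
  have root: "is_root p z \<longleftrightarrow> z \<in> carrier L \<and> z [^] N = \<one>" for z
  proof -
    have "p \<noteq> []" using deg N by auto
    then show ?thesis unfolding is_root_def by (metis evp nat_pow_closed one_closed r_right_minus_eq)
  qed
  have simple: "alg_mult p z \<le> 1" if z: "is_root p z" for z
  proof (rule ccontr)
    assume "\<not> alg_mult p z \<le> 1"
    then have "2 \<le> alg_mult p z" by simp
    have zc [simp]: "z \<in> carrier L" and zN: "z [^] N = \<one>" using z root by auto
    \<comment> \<open>Polynomials are coefficient lists with nonzero head, so \<open>[z]\<close> is
      a valid constant polynomial only for nonzero z.\<close>
    have "z \<noteq> \<zero>" using zN j by auto
    define v where "v = [\<one>, \<ominus> z]"
    have v [simp]: "v \<in> carrier (poly_ring L)"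
      by (simp add: v_def univ_poly_carrier[symmetric] polynomial_def)
    have c [simp]: "[z] \<in> carrier (poly_ring L)"
      using \<open>z \<noteq> \<zero>\<close> by (simp add: univ_poly_carrier[symmetric] polynomial_def)
    have Xv: "X = v \<oplus>\<^bsub>poly_ring L\<^esub> [z]"
      by (simp add: v_def var_def univ_poly_add l_neg)
    have vX: "X \<ominus>\<^bsub>poly_ring L\<^esub> [z] = v"
      unfolding Xv by (simp add: P.minus_eq P.a_assoc P.r_neg)
    have cN: "[z] [^]\<^bsub>poly_ring L\<^esub> N = \<one>\<^bsub>poly_ring L\<^esub>"
    proof -
      interpret k: ring_hom_cring L "poly_ring L" poly_of_const
        using canonical_embedding_ring_hom[OF carrier_is_subring]
        by (simp add: ring_hom_cring_def ring_hom_ring_def ring_hom_cring_axioms_def ring_hom_ring_axioms_def is_cring P.is_cring)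
      have "poly_of_const (z [^] N) = poly_of_const z [^]\<^bsub>poly_ring L\<^esub> N" by simp
      then show ?thesis using \<open>z \<noteq> \<zero>\<close> unfolding zN by (simp add: poly_of_const_def univ_poly_one)
    qed
    define G where "G = P.geom [z] X N"
    have G [simp]: "G \<in> carrier (poly_ring L)" by (simp add: G_def)
    have vG: "v \<otimes>\<^bsub>poly_ring L\<^esub> G = p"
      using P.geom_mult[OF c X, of N] unfolding vX cN by (simp add: G_def p_def)
    have "(v [^]\<^bsub>poly_ring L\<^esub> (2::nat)) pdivides p"
      using le_alg_mult_imp_pdivides[OF zc p \<open>2 \<le> alg_mult p z\<close>] by (simp add: v_def)
    then obtain q where q [simp]: "q \<in> carrier (poly_ring L)" and "p = v [^]\<^bsub>poly_ring L\<^esub> (2::nat) \<otimes>\<^bsub>poly_ring L\<^esub> q"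
      unfolding pdivides_def factor_def by blast
    \<comment> \<open>Cancelling one factor X - z shows that X - z still divides the geometric sum,
      so z would be a root of it.\<close>
    then have "v \<otimes>\<^bsub>poly_ring L\<^esub> G = v \<otimes>\<^bsub>poly_ring L\<^esub> (v \<otimes>\<^bsub>poly_ring L\<^esub> q)"
      using vG by (simp add: numeral_2_eq_2 P.m_assoc)
    moreover have "v \<noteq> \<zero>\<^bsub>poly_ring L\<^esub>" by (simp add: v_def univ_poly_zero)
    ultimately have "G = v \<otimes>\<^bsub>poly_ring L\<^esub> q" using P.m_lcancel[of v G "v \<otimes>\<^bsub>poly_ring L\<^esub> q"] by simp
    moreover
    interpret e: ring_hom_cring "poly_ring L" L "\<lambda>p. eval p z" by (rule ev[OF zc])
    have "eval v z = \<zero>" by (simp add: v_def r_neg)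
    ultimately have "eval G z = \<zero>" using e.hom_mult[OF v q] e.hom_closed[OF q] by simp
    moreover have "eval G z = geom z z N"
      using e.hom_geom[OF c X, of N] eval_var[OF zc] by (simp add: G_def)
    ultimately have "[N] \<cdot> (z [^] j) = \<zero>" unfolding j using geom_same[OF zc, of j] by simp
    then have "([N] \<cdot> (z [^] j)) \<otimes> z = \<zero>" by simp
    then have "[N] \<cdot> (z [^] j \<otimes> z) = \<zero>" by (simp only: add_pow_ldistr nat_pow_closed zc)
    then show False using zN inv unfolding j by simp
  qed
  have cnt: "count (roots p) z = (if is_root p z then 1 else 0)" for z
  proof -
    have "alg_mult p z = (if is_root p z then 1 else 0)"
      using simple[of z] alg_mult_gt_zero_iff_is_root[OF p, of z] by (cases "is_root p z") auto
    then show ?thesis by (simp only: alg_mult_eq_count_roots[OF p])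
  qed
  have set: "set_mset (roots p) = {z \<in> carrier L. z [^] N = \<one>}"
    using roots_mem_iff_is_root[OF p] root by blast
  have "size (roots p) = (\<Sum>z \<in> set_mset (roots p). count (roots p) z)" by (rule size_multiset_overloaded_eq)
  also have "\<dots> = (\<Sum>z \<in> set_mset (roots p). 1)"
    by (rule sum.cong) (use cnt roots_mem_iff_is_root[OF p] in auto)
  finally have "size (roots p) = card (set_mset (roots p))" by simp
  moreover have "size (roots p) = N" using roots_over_carrier[OF p] deg by (simp add: splitted_def)
  ultimately show "card {z \<in> carrier L. z [^] N = \<one>} = N" using set by simp
  show "finite {z \<in> carrier L. z [^] N = \<one>}" unfolding set[symmetric] by simp
qed

section \<open>Associated primes of the quotient ring\<close>

lemma (in cring) colon_ideal:
  assumes "ideal J R" and a: "a \<in> carrier R"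
  shows "ideal {r \<in> carrier R. r \<otimes> a \<in> J} R"
proof -
  interpret J: ideal J R by fact
  show ?thesis
  proof (rule idealI[OF ring_axioms])
    show "subgroup {r \<in> carrier R. r \<otimes> a \<in> J} (add_monoid R)"
    proof (rule add.subgroupI)
      show "{r \<in> carrier R. r \<otimes> a \<in> J} \<noteq> {}" using a by (auto intro!: exI[of _ \<zero>])
    qed (use a in \<open>auto simp: l_distr l_minus J.a_closed J.a_inv_closed\<close>)
  next
    fix r u assume "r \<in> {r \<in> carrier R. r \<otimes> a \<in> J}" and u: "u \<in> carrier R"
    then have r: "r \<in> carrier R" "r \<otimes> a \<in> J" by auto
    have "u \<otimes> (r \<otimes> a) \<in> J" using J.I_l_closed[OF r(2) u] .
    then show "u \<otimes> r \<in> {r \<in> carrier R. r \<otimes> a \<in> J}" "r \<otimes> u \<in> {r \<in> carrier R. r \<otimes> a \<in> J}"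
      using r u a by (simp_all add: m_ac)
  qed
qed

lemma (in cring) mem_genideal_pair:
  assumes a: "a \<in> carrier R" and b: "b \<in> carrier R"
  shows "u \<in> Idl {a, b} \<longleftrightarrow> (\<exists>p \<in> carrier R. \<exists>q \<in> carrier R. u = p \<otimes> a \<oplus> q \<otimes> b)"
proof
  have ab: "{a, b} \<subseteq> PIdl a <+> PIdl b"
  proof -
    have "a = \<one> \<otimes> a \<oplus> \<zero> \<otimes> b" "b = \<zero> \<otimes> a \<oplus> \<one> \<otimes> b" using a b by auto
    then show ?thesis unfolding set_add_def' cgenideal_def by blast
  qed
  have "ideal (PIdl a <+> PIdl b) R" using a b by (intro add_ideals cgenideal_ideal)
  then have "Idl {a, b} \<subseteq> PIdl a <+> PIdl b" using ab by (rule genideal_minimal)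
  then show "u \<in> Idl {a, b} \<Longrightarrow> \<exists>p \<in> carrier R. \<exists>q \<in> carrier R. u = p \<otimes> a \<oplus> q \<otimes> b"
    unfolding set_add_def' cgenideal_def by blast
next
  interpret I: ideal "Idl {a, b}" R using a b by (intro genideal_ideal) auto
  assume "\<exists>p \<in> carrier R. \<exists>q \<in> carrier R. u = p \<otimes> a \<oplus> q \<otimes> b"
  then show "u \<in> Idl {a, b}" using genideal_self[of "{a, b}"] a b I.I_l_closed I.a_closed by auto
qed

lemma (in cring) quotient_pair_ideal:
  assumes F: "F \<in> carrier R" and a: "a \<in> carrier R" and b: "b \<in> carrier R" and u: "u \<in> carrier R"
  shows "PIdl F +> u \<in> Idl\<^bsub>R Quot PIdl F\<^esub> {PIdl F +> a, PIdl F +> b} \<longleftrightarrow>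
    u \<in> {p \<otimes> a \<oplus> q \<otimes> b \<oplus> r \<otimes> F | p q r. p \<in> carrier R \<and> q \<in> carrier R \<and> r \<in> carrier R}"
proof -
  define I where "I = PIdl F"
  have I: "ideal I R" unfolding I_def by (rule cgenideal_ideal[OF F])
  have carr: "carrier (R Quot I) = (\<lambda>p. I +> p) ` carrier R"
    by (auto simp: FactRing_def A_RCOSETS_def')
  interpret I: ideal I R by (rule I)
  have Q: "cring (R Quot I)" by (rule I.quotient_is_cring[OF is_cring])
  have q: "ring_hom_cring R (R Quot I) ((+>) I)"
    by (rule ring_hom_cringI[OF is_cring Q I.rcos_ring_hom])
  interpret Q: cring "R Quot I" by (rule Q)
  interpret q: ring_hom_cring R "R Quot I" "(+>) I" by (rule q)
  have "I +> u \<in> Idl\<^bsub>R Quot I\<^esub> {I +> a, I +> b} \<longleftrightarrow>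
      (\<exists>p \<in> carrier R. \<exists>q \<in> carrier R. I +> u = I +> (p \<otimes> a \<oplus> q \<otimes> b))"
    using a b by (simp add: Q.mem_genideal_pair carr)
  also have "\<dots> \<longleftrightarrow> (\<exists>p \<in> carrier R. \<exists>q \<in> carrier R. u \<ominus> (p \<otimes> a \<oplus> q \<otimes> b) \<in> I)"
    using quotient_eq_iff_same_a_r_cos[OF I u] a b by simp
  also have "\<dots> \<longleftrightarrow> (\<exists>p \<in> carrier R. \<exists>q \<in> carrier R. \<exists>r \<in> carrier R. u = p \<otimes> a \<oplus> q \<otimes> b \<oplus> r \<otimes> F)"
  proof -
    have mem: "w \<in> I \<longleftrightarrow> (\<exists>r \<in> carrier R. w = r \<otimes> F)" for w
      unfolding I_def cgenideal_def by blast
    have iff: "u \<ominus> v = w \<longleftrightarrow> u = v \<oplus> w" if "v \<in> carrier R" "w \<in> carrier R" for v w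
      using that u by (metis a_comm a_minus_def add.inv_closed add.inv_solve_right)
    show ?thesis unfolding mem by (intro bex_cong refl iff) (use a b F in simp_all)
  qed
  finally show ?thesis unfolding I_def by blast
qed

text \<open>The annihilator of the class of a pulls back to the kernel of \<phi>, which is prime
  because D is a domain. The membership criterion is kept in the conclusion so that primes from
  different \<phi> can be told apart.\<close>

lemma (in cring) kernel_mem_ass_quot:
  assumes F: "F \<in> carrier R" and \<alpha>: "\<alpha> \<in> carrier R" and \<beta>: "\<beta> \<in> carrier R" and a: "a \<in> carrier R"
    and D: "domain D" and \<phi>: "\<phi> \<in> ring_hom R D"
    and ann: "\<And>r. r \<in> carrier R \<Longrightarrow> r \<otimes> a \<in> {p \<otimes> \<alpha> \<oplus> q \<otimes> \<beta> \<oplus> r \<otimes> F | p q r.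
      p \<in> carrier R \<and> q \<in> carrier R \<and> r \<in> carrier R} \<longleftrightarrow> \<phi> r = \<zero>\<^bsub>D\<^esub>"
  shows "\<exists>P \<in> ass_quot (R Quot PIdl F) (Idl\<^bsub>R Quot PIdl F\<^esub> {PIdl F +> \<alpha>, PIdl F +> \<beta>}).
    \<forall>r \<in> carrier R. PIdl F +> r \<in> P \<longleftrightarrow> \<phi> r = \<zero>\<^bsub>D\<^esub>"
proof -
  define I where "I = PIdl F"
  have I: "ideal I R" unfolding I_def by (rule cgenideal_ideal[OF F])
  have carr: "carrier (R Quot I) = (\<lambda>p. I +> p) ` carrier R"
    by (auto simp: FactRing_def A_RCOSETS_def')
  interpret I: ideal I R by (rule I)
  have Q: "cring (R Quot I)" by (rule I.quotient_is_cring[OF is_cring])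
  have q: "ring_hom_cring R (R Quot I) ((+>) I)"
    by (rule ring_hom_cringI[OF is_cring Q I.rcos_ring_hom])
  interpret Q: cring "R Quot I" by (rule Q)
  interpret q: ring_hom_cring R "R Quot I" "(+>) I" by (rule q)
  interpret D: domain D by (rule D)
  interpret \<phi>: ring_hom_cring R D \<phi> by (rule ring_hom_cringI[OF is_cring D.is_cring \<phi>])
  define J where "J = Idl\<^bsub>R Quot I\<^esub> {I +> \<alpha>, I +> \<beta>}"
  have J: "ideal J (R Quot I)" unfolding J_def using \<alpha> \<beta> by (intro Q.genideal_ideal) auto
  define P where "P = {r \<in> carrier (R Quot I). r \<otimes>\<^bsub>R Quot I\<^esub> (I +> a) \<in> J}"
  have P: "I +> r \<in> P \<longleftrightarrow> \<phi> r = \<zero>\<^bsub>D\<^esub>" if r: "r \<in> carrier R" for r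
  proof -
    have "I +> r \<in> P \<longleftrightarrow> I +> (r \<otimes> a) \<in> J" using r a by (simp add: P_def)
    also have "\<dots> \<longleftrightarrow> \<phi> r = \<zero>\<^bsub>D\<^esub>"
      using quotient_pair_ideal[OF F \<alpha> \<beta>, of "r \<otimes> a"] ann[OF r] r a unfolding J_def I_def by simp
    finally show ?thesis .
  qed
  have "primeideal P (R Quot I)"
  proof (rule primeidealI)
    show "ideal P (R Quot I)" unfolding P_def by (rule Q.colon_ideal[OF J]) (use a in simp)
    show "cring (R Quot I)" by (rule Q)
    have "I +> \<one> \<notin> P" using P[OF one_closed] by simp
    then show "carrier (R Quot I) \<noteq> P" using q.hom_closed[OF one_closed] by blast
    fix u v assume "u \<in> carrier (R Quot I)" "v \<in> carrier (R Quot I)" and uv: "u \<otimes>\<^bsub>R Quot I\<^esub> v \<in> P"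
    then obtain u' v' where *: "u' \<in> carrier R" "v' \<in> carrier R" "u = I +> u'" "v = I +> v'"
      unfolding carr by blast
    then have "I +> (u' \<otimes> v') \<in> P" using uv by simp
    then have "\<phi> u' \<otimes>\<^bsub>D\<^esub> \<phi> v' = \<zero>\<^bsub>D\<^esub>" using P[of "u' \<otimes> v'"] * by simp
    then have "\<phi> u' = \<zero>\<^bsub>D\<^esub> \<or> \<phi> v' = \<zero>\<^bsub>D\<^esub>" using * by (simp add: D.integral_iff)
    then show "u \<in> P \<or> v \<in> P" using P * by blast
  qed
  then have "P \<in> ass_quot (R Quot I) J"
    unfolding ass_quot_def P_def using q.hom_closed[OF a] by blast
  then show ?thesis using P unfolding J_def I_def by blast
qed

lemma ring_hom_const_UP:
  assumes "cring R" shows "(\<lambda>a. up_ring.monom (UP R) a 0) \<in> ring_hom R (UP R)"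
proof -
  interpret UP_cring R "UP R" using assms by (simp_all add: UP_cring_def)
  show ?thesis by (rule const_ring_hom)
qed

section \<open>Application to k[x,y,s,t]\<close>

lemma four_generated_Spoly:
  assumes K: "field K"
  shows "four_generated (Spoly K) K (const4 K) (varx K) (vary K) (vars K) (vart K)"
proof -
  interpret K: field K by (rule K)
  note Kc = K.is_cring
  show ?thesis
  proof (intro four_generated.intro four_generated_axioms.intro cring_Spoly[OF Kc] K
      const4_ring_hom[OF Kc] Spoly_vars_closed[OF Kc], goal_cases)
    case (1 Q p)
    show ?case by (rule Spoly_induct[OF Kc, of p Q, OF 1])
  qed
qed

text \<open>\<phi>(t^k - s^k) = (\<zeta>^k - 1) w^k, so the prime remembers for which k the power
  \<zeta>^k is 1.\<close>

lemma Spoly_ass_prime: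
  fixes K :: "('a, 'm) ring_scheme" and L :: "('l, 'n) ring_scheme" and m :: nat
  assumes K: "field K" and L: "field L" and \<iota>: "\<iota> \<in> ring_hom K L" and \<zeta>: "\<zeta> \<in> carrier L"
    and unity: "\<zeta> [^]\<^bsub>L\<^esub> (m + 1) = \<one>\<^bsub>L\<^esub>" and not_one: "\<zeta> \<noteq> \<one>\<^bsub>L\<^esub>"
    and inv: "add_pow L (m + 1) \<one>\<^bsub>L\<^esub> \<noteq> \<zero>\<^bsub>L\<^esub>"
  shows "\<exists>P \<in> ass_quot (ringR K) (Idl\<^bsub>ringR K\<^esub> {xR K [^]\<^bsub>ringR K\<^esub> (m + 2), yR K [^]\<^bsub>ringR K\<^esub> (m + 2)}).
    \<forall>k. PIdl\<^bsub>Spoly K\<^esub> (polyF K) +>\<^bsub>Spoly K\<^esub> (vart K [^]\<^bsub>Spoly K\<^esub> k \<ominus>\<^bsub>Spoly K\<^esub> vars K [^]\<^bsub>Spoly K\<^esub> k) \<in> P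
      \<longleftrightarrow> \<zeta> [^]\<^bsub>L\<^esub> (k::nat) = \<one>\<^bsub>L\<^esub>"
proof -
  interpret K: field K by (rule K)
  interpret L: field L by (rule L)
  interpret B: UP_domain L "UP L" by unfold_locales simp
  interpret C: UP_domain "UP L" "UP (UP L)" by unfold_locales simp
  note Kc = K.is_cring
  interpret S: cring "Spoly K" by (rule cring_Spoly[OF Kc])
  define \<psi> where "\<psi> = (\<lambda>a. up_ring.monom (UP L) a 0) \<circ> \<iota>"
  have \<psi>: "\<psi> \<in> ring_hom K (UP L)"
    unfolding \<psi>_def by (rule ring_hom_trans[OF \<iota> ring_hom_const_UP[OF L.is_cring]])
  obtain \<phi> where \<phi>: "\<phi> \<in> ring_hom (Spoly K) (UP L)" "\<phi> (varx K) = \<zero>\<^bsub>UP L\<^esub>" "\<phi> (vary K) = \<zero>\<^bsub>UP L\<^esub>"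
    "\<phi> (vars K) = up_ring.monom (UP L) \<one>\<^bsub>L\<^esub> 1" "\<phi> (vart K) = up_ring.monom (UP L) \<zeta> 1"
    "\<And>a. a \<in> carrier K \<Longrightarrow> \<phi> (const4 K a) = \<psi> a"
    using Spoly_hom_exists[OF Kc B.UP_cring \<psi> B.zero_closed B.zero_closed
        B.monom_closed[OF L.one_closed] B.monom_closed[OF \<zeta>]] by blast
  interpret \<phi>: ring_hom_cring "Spoly K" "UP L" \<phi>
    by (rule ring_hom_cringI[OF S.is_cring B.UP_cring \<phi>(1)])
  have "four_generated_unity (Spoly K) K (const4 K) (varx K) (vary K) (vars K) (vart K) L \<iota> \<zeta> \<phi> m"
  proof (intro four_generated_unity.intro four_generated_root.intro four_generated_Spoly[OF K]
      four_generated_root_axioms.intro four_generated_unity_axioms.intro)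
    fix \<xi> \<eta> \<tau> assume *: "\<xi> \<in> carrier (UP (UP L))" "\<eta> \<in> carrier (UP (UP L))" "\<tau> \<in> carrier (UP (UP L))"
    have "(\<lambda>a. up_ring.monom (UP (UP L)) a 0) \<circ> \<psi> \<in> ring_hom K (UP (UP L))"
      by (rule ring_hom_trans[OF \<psi> ring_hom_const_UP[OF B.UP_cring]])
    from Spoly_hom_exists[OF Kc C.UP_cring this *(1,2) C.monom_closed *(3), of "\<phi> (vars K)" 0]
    show "\<exists>h\<in>ring_hom (Spoly K) (UP (UP L)). h (varx K) = \<xi> \<and> h (vary K) = \<eta>
        \<and> h (vars K) = up_ring.monom (UP (UP L)) (\<phi> (vars K)) 0 \<and> h (vart K) = \<tau>
        \<and> (\<forall>a\<in>carrier K. h (const4 K a) = up_ring.monom (UP (UP L)) (\<phi> (const4 K a)) 0)"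
      using \<phi>(6) \<phi>.hom_closed[OF Spoly_vars_closed(3)[OF Kc]] by (simp add: \<phi>(4))
  qed (use assms \<phi> in \<open>simp_all add: \<psi>_def del: One_nat_def\<close>)
  then interpret U: four_generated_unity "Spoly K" K "const4 K" "varx K" "vary K" "vars K" "vart K" L \<iota> \<zeta> \<phi> m .
  have F: "polyF K = U.F" by (simp add: polyF_def Let_def U.F_def)
  obtain a where a: "a \<in> carrier (Spoly K)"
    "\<And>r. r \<in> carrier (Spoly K) \<Longrightarrow> r \<otimes>\<^bsub>Spoly K\<^esub> a \<in> U.J (m + 2) \<longleftrightarrow> \<phi> r = \<zero>\<^bsub>UP L\<^esub>"
    using U.annihilator_eq_kernel by blast
  define I where "I = PIdl\<^bsub>Spoly K\<^esub> (polyF K)"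
  have q: "ring_hom_cring (Spoly K) (ringR K) (\<lambda>u. I +>\<^bsub>Spoly K\<^esub> u)"
  proof -
    have "ideal I (Spoly K)" unfolding I_def F by (rule S.cgenideal_ideal[OF U.F_closed])
    then show ?thesis
      unfolding ringR_def I_def[symmetric]
      by (intro ring_hom_cringI S.is_cring ideal.quotient_is_cring ideal.rcos_ring_hom)
  qed
  interpret q: ring_hom_cring "Spoly K" "ringR K" "\<lambda>u. I +>\<^bsub>Spoly K\<^esub> u" by (rule q)
  have pow: "xR K [^]\<^bsub>ringR K\<^esub> (m + 2) = I +>\<^bsub>Spoly K\<^esub> (varx K [^]\<^bsub>Spoly K\<^esub> (m + 2))"
    "yR K [^]\<^bsub>ringR K\<^esub> (m + 2) = I +>\<^bsub>Spoly K\<^esub> (vary K [^]\<^bsub>Spoly K\<^esub> (m + 2))"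
    unfolding xR_def yR_def I_def[symmetric]
    by (simp_all only: q.hom_pow Spoly_vars_closed[OF Kc])
  have "\<exists>P \<in> ass_quot (ringR K) (Idl\<^bsub>ringR K\<^esub> {xR K [^]\<^bsub>ringR K\<^esub> (m + 2), yR K [^]\<^bsub>ringR K\<^esub> (m + 2)}).
    \<forall>r \<in> carrier (Spoly K). I +>\<^bsub>Spoly K\<^esub> r \<in> P \<longleftrightarrow> \<phi> r = \<zero>\<^bsub>UP L\<^esub>"
    unfolding pow unfolding I_def ringR_def F
  proof (rule S.kernel_mem_ass_quot[OF _ _ _ a(1) B.UP_domain \<phi>(1)])
    fix r assume "r \<in> carrier (Spoly K)"
    from a(2)[OF this] show "r \<otimes>\<^bsub>Spoly K\<^esub> a
         \<in> {p \<otimes>\<^bsub>Spoly K\<^esub> varx K [^]\<^bsub>Spoly K\<^esub> (m + 2) \<oplus>\<^bsub>Spoly K\<^esub> q \<otimes>\<^bsub>Spoly K\<^esub> vary K [^]\<^bsub>Spoly K\<^esub> (m + 2) \<oplus>\<^bsub>Spoly K\<^esub>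
            r \<otimes>\<^bsub>Spoly K\<^esub> U.F |p q r. p \<in> carrier (Spoly K) \<and> q \<in> carrier (Spoly K) \<and> r \<in> carrier (Spoly K)}
         \<longleftrightarrow> \<phi> r = \<zero>\<^bsub>UP L\<^esub>"
      unfolding U.J_def .
  qed simp_all
  moreover have "\<phi> (vart K [^]\<^bsub>Spoly K\<^esub> k \<ominus>\<^bsub>Spoly K\<^esub> vars K [^]\<^bsub>Spoly K\<^esub> k) = \<zero>\<^bsub>UP L\<^esub> \<longleftrightarrow> \<zeta> [^]\<^bsub>L\<^esub> k = \<one>\<^bsub>L\<^esub>" for k :: nat
  proof -
    have 1: "\<phi> (vart K [^]\<^bsub>Spoly K\<^esub> k \<ominus>\<^bsub>Spoly K\<^esub> vars K [^]\<^bsub>Spoly K\<^esub> k)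
        = up_ring.monom (UP L) (\<zeta> [^]\<^bsub>L\<^esub> k) k \<ominus>\<^bsub>UP L\<^esub> up_ring.monom (UP L) \<one>\<^bsub>L\<^esub> k"
      by (simp only: U.\<phi>_minus U.\<phi>_pow S.nat_pow_closed U.gens_closed)
    have 2: "up_ring.monom (UP L) (\<zeta> [^]\<^bsub>L\<^esub> k) k \<ominus>\<^bsub>UP L\<^esub> up_ring.monom (UP L) \<one>\<^bsub>L\<^esub> k = \<zero>\<^bsub>UP L\<^esub> \<longleftrightarrow> up_ring.monom (UP L) (\<zeta> [^]\<^bsub>L\<^esub> k) k = up_ring.monom (UP L) \<one>\<^bsub>L\<^esub> k"
      using \<zeta> by (intro B.r_right_minus_eq) auto
    have 3: "up_ring.monom (UP L) (\<zeta> [^]\<^bsub>L\<^esub> k) k = up_ring.monom (UP L) \<one>\<^bsub>L\<^esub> k \<longleftrightarrow> \<zeta> [^]\<^bsub>L\<^esub> k = \<one>\<^bsub>L\<^esub>"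
      using B.monom_inj[of k] \<zeta> by (auto simp: inj_on_def)
    show ?thesis unfolding 1 2 3 ..
  qed
  ultimately show ?thesis unfolding I_def by (metis S.minus_closed S.nat_pow_closed U.gens_closed(3,4))
qed

section \<open>Infinitely many primes from infinitely many roots of unity\<close>

theorem theorem2p1:
  fixes K :: "('a, 'm) ring_scheme" and \<S> :: "nat set"
  assumes "field K"
    and "infinite \<S>" and "\<forall>n \<in> \<S>. n > 0"
    and "(\<forall>n::nat. n > 0 \<longrightarrow> add_pow K n \<one>\<^bsub>K\<^esub> \<noteq> \<zero>\<^bsub>K\<^esub>)
         \<or> (\<exists>p::nat. Factorial_Ring.prime p \<and> add_pow K p \<one>\<^bsub>K\<^esub> = \<zero>\<^bsub>K\<^esub>
               \<and> infinite {n \<in> \<S>. \<exists>e::nat. n = p ^ e})"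
  shows "infinite (\<Union>n \<in> \<S>. ass_quot (ringR K)
           (Idl\<^bsub>ringR K\<^esub> {xR K [^]\<^bsub>ringR K\<^esub> n, yR K [^]\<^bsub>ringR K\<^esub> n}))"
proof
  let ?U = "\<Union>n \<in> \<S>. ass_quot (ringR K) (Idl\<^bsub>ringR K\<^esub> {xR K [^]\<^bsub>ringR K\<^esub> n, yR K [^]\<^bsub>ringR K\<^esub> n})"
  let ?w = "\<lambda>k. PIdl\<^bsub>Spoly K\<^esub> (polyF K) +>\<^bsub>Spoly K\<^esub>
    (vart K [^]\<^bsub>Spoly K\<^esub> (k::nat) \<ominus>\<^bsub>Spoly K\<^esub> vars K [^]\<^bsub>Spoly K\<^esub> k)"
  assume fin: "finite ?U"
  interpret K: field K by fact
  define L where "L = K.alg_closure"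
  define \<iota> where "\<iota> = (K.indexed_const :: 'a \<Rightarrow> ('a list \<times> nat) multiset \<Rightarrow> 'a)"
  have \<iota>: "\<iota> \<in> ring_hom K L" using K.alg_closureE(2) by (simp add: L_def \<iota>_def)
  interpret L: algebraic_closure L "\<iota> ` carrier K" using K.alg_closureE(1) by (simp add: L_def \<iota>_def)
  have inv: "add_pow L n \<one>\<^bsub>L\<^esub> \<noteq> \<zero>\<^bsub>L\<^esub>" if "add_pow K n \<one>\<^bsub>K\<^esub> \<noteq> \<zero>\<^bsub>K\<^esub>" for n :: nat
  proof -
    interpret i: ring_hom_cring K L \<iota> by (rule ring_hom_cringI[OF K.is_cring L.is_cring \<iota>])
    have hp: "\<iota> (add_pow K n \<one>\<^bsub>K\<^esub>) = add_pow L n \<one>\<^bsub>L\<^esub>" by (induction n) simp_all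
    have "inj_on \<iota> (carrier K)" by (rule non_trivial_field_hom_is_inj[OF \<iota> K.field_axioms L.field_axioms])
    then have "\<iota> (add_pow K n \<one>\<^bsub>K\<^esub>) \<noteq> \<iota> \<zero>\<^bsub>K\<^esub>"
      using that inj_onD[of \<iota> "carrier K" "add_pow K n \<one>\<^bsub>K\<^esub>" "\<zero>\<^bsub>K\<^esub>"] by blast
    then show ?thesis using hp by simp
  qed
  \<comment> \<open>The usable n: N = n - 1 is invertible in K, and N >= 2, so that roots of unity
    other than 1 occur.\<close>
  define A where "A = {n \<in> \<S>. n \<ge> 3 \<and> add_pow K (n - 1) \<one>\<^bsub>K\<^esub> \<noteq> \<zero>\<^bsub>K\<^esub>}"
  have "infinite A"
    using assms(4)
  proof
    assume char0: "\<forall>n::nat. n > 0 \<longrightarrow> add_pow K n \<one>\<^bsub>K\<^esub> \<noteq> \<zero>\<^bsub>K\<^esub>"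
    have "\<S> - {..<3} \<subseteq> A" using char0 by (auto simp: A_def)
    moreover have "infinite (\<S> - {..<3})" using assms(2) by simp
    ultimately show ?thesis using infinite_super by blast
  next
    assume "\<exists>p::nat. Factorial_Ring.prime p \<and> add_pow K p \<one>\<^bsub>K\<^esub> = \<zero>\<^bsub>K\<^esub>
               \<and> infinite {n \<in> \<S>. \<exists>e::nat. n = p ^ e}"
    then obtain p :: nat where p: "add_pow K p \<one>\<^bsub>K\<^esub> = \<zero>\<^bsub>K\<^esub>" and inf: "infinite {n \<in> \<S>. \<exists>e::nat. n = p ^ e}"
      by blast
    have "{n \<in> \<S>. \<exists>e::nat. n = p ^ e} - {..<3} \<subseteq> A"
    proof
      fix n assume n: "n \<in> {n \<in> \<S>. \<exists>e::nat. n = p ^ e} - {..<3}"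
      then obtain e where e: "n = p ^ e" by auto
      \<comment> \<open>p^0 = 1 was removed with the n below 3. A positive power of p is zero in K,
        so n - 1 equals -1 there and is invertible.\<close>
      have "e \<noteq> 0"
      proof
        assume "e = 0" then show False using n e by auto
      qed
      then obtain k where "n = p * k" using e by (cases e) auto
      then have 0: "add_pow K n \<one>\<^bsub>K\<^esub> = \<zero>\<^bsub>K\<^esub>"
        using K.add.nat_pow_pow[of "\<one>\<^bsub>K\<^esub>" k p] p by (simp add: mult.commute)
      have "add_pow K (n - 1) \<one>\<^bsub>K\<^esub> \<noteq> \<zero>\<^bsub>K\<^esub>"
      proof
        assume "add_pow K (n - 1) \<one>\<^bsub>K\<^esub> = \<zero>\<^bsub>K\<^esub>"
        moreover have "add_pow K n \<one>\<^bsub>K\<^esub> = add_pow K (n - 1) \<one>\<^bsub>K\<^esub> \<oplus>\<^bsub>K\<^esub> \<one>\<^bsub>K\<^esub>"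
          using n K.add.nat_pow_Suc[of "n - 1" "\<one>\<^bsub>K\<^esub>"] by simp
        ultimately show False using 0 by simp
      qed
      then show "n \<in> A" using n by (auto simp: A_def)
    qed
    moreover have "infinite ({n \<in> \<S>. \<exists>e::nat. n = p ^ e} - {..<3})" using inf by simp
    ultimately show ?thesis using infinite_super by blast
  qed
  define rootset where "rootset = (\<lambda>n::nat. {z \<in> carrier L. z [^]\<^bsub>L\<^esub> (n - 1) = \<one>\<^bsub>L\<^esub>})"
  have card: "card (rootset n) = n - 1" and finite_roots: "finite (rootset n)" if "n \<in> A" for n
    using L.card_roots_of_unity[of "n - 1"] inv[of "n - 1"] that by (auto simp: A_def rootset_def)
  define Z where "Z = (\<Union>n \<in> A. rootset n) - {\<one>\<^bsub>L\<^esub>}"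
  \<comment> \<open>The root sets have n - 1 elements, which is unbounded over the infinite set
    A.\<close>
  have "infinite Z"
  proof
    assume Z: "finite Z"
    obtain n where n: "n \<in> A" "n > card Z + 2"
      using \<open>infinite A\<close> infinite_nat_iff_unbounded[of A] by blast
    have "rootset n \<subseteq> insert \<one>\<^bsub>L\<^esub> Z" using n by (auto simp: Z_def)
    then have "card (rootset n) \<le> card (insert \<one>\<^bsub>L\<^esub> Z)" using Z by (intro card_mono) auto
    moreover have "card (insert \<one>\<^bsub>L\<^esub> Z) \<le> card Z + 1" by (rule card_insert_le_m1) simp_all
    ultimately show False using card[OF n(1)] n(2) by linarith
  qed
  have "\<exists>P \<in> ?U. \<forall>k. ?w k \<in> P \<longleftrightarrow> z [^]\<^bsub>L\<^esub> k = \<one>\<^bsub>L\<^esub>" if z: "z \<in> Z" for z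
  proof -
    obtain n where n: "n \<in> A" "z \<in> carrier L" "z [^]\<^bsub>L\<^esub> (n - 1) = \<one>\<^bsub>L\<^esub>" "z \<noteq> \<one>\<^bsub>L\<^esub>"
      using z by (auto simp: Z_def rootset_def)
    define m where "m = n - 2"
    have m: "n - 1 = m + 1" "n = m + 2" using n(1) by (auto simp: m_def A_def)
    have "add_pow L (m + 1) \<one>\<^bsub>L\<^esub> \<noteq> \<zero>\<^bsub>L\<^esub>" using inv[of "n - 1"] n(1) m by (simp add: A_def)
    then obtain P where "P \<in> ass_quot (ringR K) (Idl\<^bsub>ringR K\<^esub> {xR K [^]\<^bsub>ringR K\<^esub> n, yR K [^]\<^bsub>ringR K\<^esub> n})"
      "\<forall>k. ?w k \<in> P \<longleftrightarrow> z [^]\<^bsub>L\<^esub> k = \<one>\<^bsub>L\<^esub>"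
      using Spoly_ass_prime[OF assms(1) L.field_axioms \<iota> n(2) n(3)[unfolded m(1)] n(4)] unfolding m(2) by blast
    moreover have "n \<in> \<S>" using n(1) by (simp add: A_def)
    ultimately show ?thesis by blast
  qed
  then have "\<forall>z \<in> Z. \<exists>P. P \<in> ?U \<and> (\<forall>k. ?w k \<in> P \<longleftrightarrow> z [^]\<^bsub>L\<^esub> k = \<one>\<^bsub>L\<^esub>)" by blast
  from bchoice[OF this] obtain P where
    "\<forall>z \<in> Z. P z \<in> ?U \<and> (\<forall>k. ?w k \<in> P z \<longleftrightarrow> z [^]\<^bsub>L\<^esub> k = \<one>\<^bsub>L\<^esub>)" by blast
  then have P: "\<And>z. z \<in> Z \<Longrightarrow> P z \<in> ?U" "\<And>z k. z \<in> Z \<Longrightarrow> ?w k \<in> P z \<longleftrightarrow> z [^]\<^bsub>L\<^esub> k = \<one>\<^bsub>L\<^esub>"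
    by blast+
  \<comment> \<open>If the primes were finitely many, one of them would serve infinitely many z.
    Testing it with k = n0 - 1 makes all these z roots of unity of one fixed order bound, and there
    are only finitely many of those.\<close>
  have "finite (P ` Z)" by (rule finite_subset[OF _ fin]) (use P(1) in blast)
  then obtain z0 where z0: "z0 \<in> Z" "infinite {z \<in> Z. P z = P z0}"
    using pigeonhole_infinite[OF \<open>infinite Z\<close>] by blast
  obtain n0 where n0: "n0 \<in> A" "z0 [^]\<^bsub>L\<^esub> (n0 - 1) = \<one>\<^bsub>L\<^esub>"
    using z0(1) by (auto simp: Z_def rootset_def)
  have "{z \<in> Z. P z = P z0} \<subseteq> rootset n0"
  proof
    fix z assume "z \<in> {z \<in> Z. P z = P z0}"
    then have z: "z \<in> Z" "P z = P z0" by auto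
    have "?w (n0 - 1) \<in> P z" using P(2)[OF z0(1)] n0(2) z(2) by simp
    then have "z [^]\<^bsub>L\<^esub> (n0 - 1) = \<one>\<^bsub>L\<^esub>" using P(2)[OF z(1)] by simp
    then show "z \<in> rootset n0" using z(1) by (auto simp: Z_def rootset_def)
  qed
  then show False using z0(2) finite_roots[OF n0(1)] finite_subset by blast
qed

end
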